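(* Let $n \geq 3$ be an integer and let $C_n$ be the cycle of length $n$. Then $C_n$ enjoys the strong exchange property if and only if $3 \leq n \leq 7$.
   Context: All graphs are finite with no loop, no multiple edge and no isolated vertex. Let $G$ be such a graph on $V(G)=\{x_1,\ldots,x_n\}$ with edge set $E(G)$, and let $S=K[x_1,\ldots,x_n]$ be the polynomial ring over a field $K$. The edge ideal $I(G)\subset S$ is generated by the monomials $x_ix_j$ with $\{x_i,x_j\}\in E(G)$. For a monomial ideal $I\subset S$ and $\mathfrak{c}=(c_1,\ldots,c_n)\in\mathbb{Z}_{>0}^n$, $I_{\mathfrak{c}}$ is the ideal generated by the monomials $x_1^{a_1}\cdots x_n^{a_n}\in I$ with $a_i\le c_i$ for all $i$, and $\delta_{\mathfrak{c}}(I)$ is the largest integer $q$ with $(I^q)_{\mathfrak{c}}\neq 0$. Let $\mathcal{W}(\mathfrak{c},G)$ be the minimal set of monomial generators of $(I(G)^{\delta})_{\mathfrak{c}}$, where $\delta=\delta_{\mathfrak{c}}(I(G))$. $\mathcal{W}(\mathfrak{c},G)$ enjoys the strong exchange property if for all $w=x_1^{a_1}\cdots x_n^{a_n}$ and $w'=x_1^{b_1}\cdots x_n^{b_n}$ in $\mathcal{W}(\mathfrak{c},G)$ and all $\xi,\rho$ with $a_\xi>b_\xi$ and $a_\rho<b_\rho$, one has $x_\rho(w/x_\xi)\in\mathcal{W}(\mathfrak{c},G)$. The graph $G$ enjoys the strong exchange property if $\mathcal{W}(\mathfrak{c},G)$ does for every $\mathfrak{c}\in\mathbb{Z}_{>0}^n$.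 $C_n$ is the graph on $\{x_1,\ldots,x_n\}$ with edges $\{x_1,x_2\},\{x_2,x_3\},\ldots,\{x_{n-1},x_n\},\{x_n,x_1\}$. *)

theory Defs
  imports "HOL-Library.Poly_Mapping" "HOL-Algebra.Ideal_Product"
begin

section \<open>Graphs\<close>

text \<open>A finite graph without loops, multiple edges or isolated vertices is given by its vertex
  set and its set of two-element edges.\<close>

definition simple_graph :: "'v set \<Rightarrow> 'v set set \<Rightarrow> bool" where
  "simple_graph V E \<longleftrightarrow> finite V \<and> (\<forall>e\<in>E. e \<subseteq> V \<and> card e = 2) \<and> V \<subseteq> \<Union>E"

definition cycle_verts :: "nat \<Rightarrow> nat set" where
  "cycle_verts n = {1..n}"

definition cycle_edges :: "nat \<Rightarrow> nat set set" where
  "cycle_edges n = {{i, i + 1} | i. 1 \<le> i \<and> i < n} \<union> {{n, 1}}"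

lemma simple_graph_cycle:
  assumes "n \<ge> 3"
  shows "simple_graph (cycle_verts n) (cycle_edges n)"
proof -
  have "v \<in> \<Union>(cycle_edges n)" if "v \<in> cycle_verts n" for v
  proof (cases "v = n")
    case False
    with that have "{v, v + 1} \<in> cycle_edges n"
      by (auto simp: cycle_verts_def cycle_edges_def)
    then show ?thesis by blast
  qed (auto simp: cycle_edges_def)
  then have "cycle_verts n \<subseteq> \<Union>(cycle_edges n)"
    by blast
  moreover have "\<forall>e\<in>cycle_edges n. e \<subseteq> cycle_verts n \<and> card e = 2"
    using assms by (auto simp: cycle_verts_def cycle_edges_def card_insert_if)
  ultimately show ?thesis
    by (simp add: simple_graph_def cycle_verts_def)
qed


section \<open>The polynomial ring on a set of variables\<close>

text \<open>A polynomial over \<^typ>\<open>'k\<close> is a finitely supported map from exponent vectors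
  \<^typ>\<open>'v \<Rightarrow>\<^sub>0 nat\<close> to coefficients; multiplication of these maps is convolution. The ring
  \<open>K[V]\<close> consists of the polynomials in which only variables from \<open>V\<close> occur.\<close>

definition poly_ring :: "'v set \<Rightarrow> (('v \<Rightarrow>\<^sub>0 nat) \<Rightarrow>\<^sub>0 'k::field) ring" where
  "poly_ring V = \<lparr>carrier = {p. \<forall>a\<in>Poly_Mapping.keys p. Poly_Mapping.keys a \<subseteq> V},
     mult = (*), one = 1, zero = 0, add = (+)\<rparr>"

lemma cring_poly_ring: "cring (poly_ring V :: (('v \<Rightarrow>\<^sub>0 nat) \<Rightarrow>\<^sub>0 'k::field) ring)"
proof -
  let ?P = "{p :: ('v \<Rightarrow>\<^sub>0 nat) \<Rightarrow>\<^sub>0 'k. \<forall>a\<in>Poly_Mapping.keys p. Poly_Mapping.keys a \<subseteq> V}"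
  have add: "p + q \<in> ?P" if "p \<in> ?P" "q \<in> ?P" for p q
    using that keys_add[of p q] by blast
  have mult: "p * q \<in> ?P" if p: "p \<in> ?P" and q: "q \<in> ?P" for p q
  proof safe
    fix x v
    assume "x \<in> Poly_Mapping.keys (p * q)" and v: "v \<in> Poly_Mapping.keys x"
    then obtain a b where "x = a + b" "a \<in> Poly_Mapping.keys p" "b \<in> Poly_Mapping.keys q"
      using keys_mult[of p q] by blast
    then show "v \<in> V"
      using p q v keys_add[of a b] by blast
  qed
  have minus: "- p \<in> ?P" if "p \<in> ?P" for p
    using that by (simp add: in_keys_iff)
  have ag: "abelian_group (poly_ring V :: (('v \<Rightarrow>\<^sub>0 nat) \<Rightarrow>\<^sub>0 'k) ring)"
    unfolding poly_ring_def
  proof (rule abelian_groupI, goal_cases)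
    case (1 p q)
    then show ?case using add[of p q] by simp
  next
    case (3 p q r)
    show ?case by (simp only: ring.simps add.assoc)
  next
    case (4 p q)
    show ?case by (simp only: ring.simps add.commute)
  next
    case (6 p)
    then show ?case using minus[of p] by (intro bexI[of _ "- p"]) simp_all
  qed simp_all
  have cm: "Group.comm_monoid (poly_ring V :: (('v \<Rightarrow>\<^sub>0 nat) \<Rightarrow>\<^sub>0 'k) ring)"
    unfolding poly_ring_def
  proof (rule comm_monoidI, goal_cases)
    case (1 p q)
    then show ?case using mult[of p q] by simp
  next
    case (3 p q r)
    show ?case by (simp only: monoid.simps mult.assoc)
  next
    case (5 p q)
    show ?case by (simp only: monoid.simps mult.commute)
  qed simp_all
  show ?thesis
    by (rule cringI[OF ag cm]) (simp add: poly_ring_def distrib_right)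
qed

definition monomial :: "('v \<Rightarrow>\<^sub>0 nat) \<Rightarrow> (('v \<Rightarrow>\<^sub>0 nat) \<Rightarrow>\<^sub>0 'k::field)" where
  "monomial a = Poly_Mapping.single a 1"

definition var :: "'v \<Rightarrow> (('v \<Rightarrow>\<^sub>0 nat) \<Rightarrow>\<^sub>0 'k::field)" where
  "var v = monomial (Poly_Mapping.single v 1)"

definition monomials :: "'v set \<Rightarrow> (('v \<Rightarrow>\<^sub>0 nat) \<Rightarrow>\<^sub>0 'k::field) set" where
  "monomials V = {monomial a | a. Poly_Mapping.keys a \<subseteq> V}"


section \<open>Restricted powers of edge ideals\<close>

definition edge_ideal :: "'v set \<Rightarrow> 'v set set \<Rightarrow> (('v \<Rightarrow>\<^sub>0 nat) \<Rightarrow>\<^sub>0 'k::field) set" where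
  "edge_ideal V E = genideal (poly_ring V) {var u * var v | u v. {u, v} \<in> E}"

text \<open>\<open>ideals_set R\<close> is the semiring of ideals of \<open>R\<close>, so its powers are the powers of an
  ideal; the zeroth power is the whole ring.\<close>

definition ideal_power ::
    "'v set \<Rightarrow> (('v \<Rightarrow>\<^sub>0 nat) \<Rightarrow>\<^sub>0 'k::field) set \<Rightarrow> nat \<Rightarrow> (('v \<Rightarrow>\<^sub>0 nat) \<Rightarrow>\<^sub>0 'k) set" where
  "ideal_power V I q = I [^]\<^bsub>ideals_set (poly_ring V)\<^esub> q"

definition restrict_ideal ::
    "'v set \<Rightarrow> ('v \<Rightarrow> nat) \<Rightarrow> (('v \<Rightarrow>\<^sub>0 nat) \<Rightarrow>\<^sub>0 'k::field) set \<Rightarrow> (('v \<Rightarrow>\<^sub>0 nat) \<Rightarrow>\<^sub>0 'k) set" where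
  "restrict_ideal V c I = genideal (poly_ring V)
     {monomial a | a. monomial a \<in> I \<and> Poly_Mapping.keys a \<subseteq> V
                      \<and> (\<forall>v\<in>V. Poly_Mapping.lookup a v \<le> c v)}"

text \<open>\<open>GREATEST\<close> is meaningful for an ideal generated by monomials of positive degree on a
  finite set \<open>V\<close>: then the condition holds for \<open>q = 0\<close> and forces \<open>q \<le> (\<Sum>v\<in>V. c v)\<close>.\<close>

definition delta :: "'v set \<Rightarrow> ('v \<Rightarrow> nat) \<Rightarrow> (('v \<Rightarrow>\<^sub>0 nat) \<Rightarrow>\<^sub>0 'k::field) set \<Rightarrow> nat" where
  "delta V c I = (GREATEST q. restrict_ideal V c (ideal_power V I q) \<noteq> {0})"

definition minimal_monomial_generators ::
    "'v set \<Rightarrow> (('v \<Rightarrow>\<^sub>0 nat) \<Rightarrow>\<^sub>0 'k::field) set \<Rightarrow> (('v \<Rightarrow>\<^sub>0 nat) \<Rightarrow>\<^sub>0 'k) set \<Rightarrow> bool" where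
  "minimal_monomial_generators V J W \<longleftrightarrow>
     W \<subseteq> monomials V \<and> genideal (poly_ring V) W = J \<and>
     (\<forall>W'. W' \<subset> W \<longrightarrow> genideal (poly_ring V) W' \<noteq> J)"

text \<open>A monomial ideal has exactly one minimal set of monomial generators, which is what
  \<open>THE\<close> selects.\<close>

definition W_set ::
    "'v set \<Rightarrow> 'v set set \<Rightarrow> ('v \<Rightarrow> nat) \<Rightarrow> (('v \<Rightarrow>\<^sub>0 nat) \<Rightarrow>\<^sub>0 'k::field) set" where
  "W_set V E c = (let I = edge_ideal V E in
     THE W. minimal_monomial_generators V
              (restrict_ideal V c (ideal_power V I (delta V c I))) W)"


section \<open>The strong exchange property\<close>

definition strong_exchange :: "'v set \<Rightarrow> (('v \<Rightarrow>\<^sub>0 nat) \<Rightarrow>\<^sub>0 'k::field) set \<Rightarrow> bool" where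
  "strong_exchange V W \<longleftrightarrow>
     (\<forall>a b. monomial a \<in> W \<longrightarrow> monomial b \<in> W \<longrightarrow>
       (\<forall>\<xi>\<in>V. \<forall>\<rho>\<in>V. Poly_Mapping.lookup a \<xi> > Poly_Mapping.lookup b \<xi> \<longrightarrow>
          Poly_Mapping.lookup a \<rho> < Poly_Mapping.lookup b \<rho> \<longrightarrow>
          var \<rho> * monomial (a - Poly_Mapping.single \<xi> 1) \<in> W))"

text \<open>The first argument fixes the coefficient field; the values of \<open>c\<close> outside \<open>V\<close> are
  irrelevant.\<close>

definition graph_strong_exchange :: "'k::field itself \<Rightarrow> 'v set \<Rightarrow> 'v set set \<Rightarrow> bool" where
  "graph_strong_exchange _ V E \<longleftrightarrow>
     (\<forall>c. (\<forall>v\<in>V. c v > 0) \<longrightarrow>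
       strong_exchange V (W_set V E c :: (('v \<Rightarrow>\<^sub>0 nat) \<Rightarrow>\<^sub>0 'k) set))"

end

theory Submission
  imports Defs "HOL-Library.Multiset"
begin

text \<open>
  A monomial of degree \<open>2q\<close> lies in \<open>I(G)\<^sup>q\<close> exactly when it is the product of \<open>q\<close> edges. Hence
  \<open>W(c,G)\<close> consists of the degree vectors of the edge multisets that have the largest possible size
  among those whose degree at each vertex \<open>v\<close> is at most \<open>c\<^sub>v\<close> (\<open>W_set_eq\<close>), and the strong exchange
  property is a statement about maximum capacitated matchings.

  Two such degree vectors always satisfy a weaker exchange: if \<open>a\<close> exceeds \<open>b\<close> at \<open>\<xi>\<close>, then one unit can
  be moved in \<open>a\<close> from \<open>\<xi>\<close> to some coordinate where \<open>a\<close> is below \<open>b\<close>, and dually one unit can be moved to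
  a prescribed such coordinate from some coordinate where \<open>a\<close> exceeds \<open>b\<close>. Both follow from one argument
  with alternating walks. A failure of the strong property at \<open>\<xi>\<close>, \<open>\<rho>\<close> therefore produces a second
  coordinate of each kind (\<open>four_inessential_exchange\<close>). All four vertices are inessential: each is left
  unsaturated by some maximum multiset.

  Let \<open>G = C\<^sub>n\<close>. If no two adjacent vertices are inessential, the four vertices form an independent set,
  so \<open>n \<ge> 8\<close>. If two adjacent vertices are inessential, then so is the next one, and hence all are
  (\<open>inessential_propagates\<close>). In that case Gallai's argument (\<open>rival_trans\<close>) shows that no maximum
  multiset leaves two distinct vertices unsaturated, and then the weak exchange is the strong one
  (\<open>rival_exchange\<close>). This proves the property for \<open>n \<le> 7\<close>.

  For \<open>n \<ge> 8\<close>, there is a bound for which the even vertices, together with \<open>n\<close>, form a tight vertex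
  cover, and two maximum multisets for which one exchange would require more edges at the vertices 5 and
  7 than their neighbours 4, 6 and 8 can supply (\<open>long_cycle_not_exchange\<close>).
\<close>

section \<open>Monomial ideals\<close>

text \<open>The ideal generated by the monomials with exponents in \<open>A\<close> (\<open>genideal_monomials\<close>), given by its
  membership test: every monomial that occurs is divisible by a generator. Divisibility of monomials is
  written additively, as existence of a complementary exponent.\<close>

definition mon_ideal ::
    "'v set \<Rightarrow> ('v \<Rightarrow>\<^sub>0 nat) set \<Rightarrow> (('v \<Rightarrow>\<^sub>0 nat) \<Rightarrow>\<^sub>0 'k::field) set" where
  "mon_ideal V A = {p \<in> carrier (poly_ring V).
     \<forall>m\<in>Poly_Mapping.keys p. \<exists>a\<in>A. \<exists>d. m = a + d}"

lemma keys_add_nat: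
  fixes a b :: "'v \<Rightarrow>\<^sub>0 nat"
  shows "Poly_Mapping.keys (a + b) = Poly_Mapping.keys a \<union> Poly_Mapping.keys b"
  by (auto simp: in_keys_iff lookup_add)

lemma monomial_mult: "monomial a * monomial b = monomial (a + b)"
  by (simp add: monomial_def mult_single)

lemma monomial_inject [simp]:
  "(monomial a :: ('v \<Rightarrow>\<^sub>0 nat) \<Rightarrow>\<^sub>0 'k::field) = monomial b \<longleftrightarrow> a = b"
proof
  assume "(monomial a :: ('v \<Rightarrow>\<^sub>0 nat) \<Rightarrow>\<^sub>0 'k) = monomial b"
  then have "Poly_Mapping.keys (monomial a :: ('v \<Rightarrow>\<^sub>0 nat) \<Rightarrow>\<^sub>0 'k) = Poly_Mapping.keys (monomial b :: ('v \<Rightarrow>\<^sub>0 nat) \<Rightarrow>\<^sub>0 'k)"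
    by simp
  then show "a = b" by (simp add: monomial_def)
qed simp

lemma keys_monomial [simp]:
  "Poly_Mapping.keys (monomial a :: ('v \<Rightarrow>\<^sub>0 nat) \<Rightarrow>\<^sub>0 'k::field) = {a}"
  by (simp add: monomial_def)

lemma carrier_poly_ring:
  "p \<in> carrier (poly_ring V) \<longleftrightarrow> (\<forall>a\<in>Poly_Mapping.keys p. Poly_Mapping.keys a \<subseteq> V)"
  by (simp add: poly_ring_def)

lemma monomial_self_in_mon_ideal:
  assumes "a \<in> A" "Poly_Mapping.keys a \<subseteq> V"
  shows "monomial a \<in> mon_ideal V A"
  unfolding mon_ideal_def carrier_poly_ring
  using assms by (auto intro!: bexI[of _ a] exI[of _ 0])

lemma monomial_in_mon_ideal:
  "monomial m \<in> mon_ideal V A \<longleftrightarrow> Poly_Mapping.keys m \<subseteq> V \<and> (\<exists>a\<in>A. \<exists>d. m = a + d)"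
  by (simp add: mon_ideal_def carrier_poly_ring)

lemma mon_ideal_subset_carrier: "mon_ideal V A \<subseteq> carrier (poly_ring V)"
  by (auto simp: mon_ideal_def)

lemma keys_neg: "Poly_Mapping.keys (- p) = Poly_Mapping.keys (p :: 'a \<Rightarrow>\<^sub>0 'b::ab_group_add)"
  by (simp add: set_eq_iff in_keys_iff del: lookup_not_eq_zero_eq_in_keys)

lemma mult_in_carrier_poly_ring:
  fixes p q :: "('v \<Rightarrow>\<^sub>0 nat) \<Rightarrow>\<^sub>0 'k::field"
  assumes "p \<in> carrier (poly_ring V)" "q \<in> carrier (poly_ring V)"
  shows "p * q \<in> carrier (poly_ring V)"
proof -
  have "monoid (poly_ring V :: (('v \<Rightarrow>\<^sub>0 nat) \<Rightarrow>\<^sub>0 'k) ring)"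
    by (intro ring.is_monoid cring.axioms(1) cring_poly_ring)
  from monoid.m_closed[OF this assms] show ?thesis by (simp add: poly_ring_def)
qed

lemma keys_multE:
  assumes "m \<in> Poly_Mapping.keys (p * q)"
  obtains x y where "m = x + y" "x \<in> Poly_Mapping.keys p" "y \<in> Poly_Mapping.keys q"
  using assms keys_mult[of p q] by blast

lemma mon_idealE:
  assumes "p \<in> mon_ideal V A" "m \<in> Poly_Mapping.keys p"
  obtains a d where "a \<in> A" "m = a + d"
  using assms unfolding mon_ideal_def by blast

lemma mon_ideal_mult_closed:
  assumes p: "p \<in> mon_ideal V A" and q: "q \<in> carrier (poly_ring V)"
  shows "p * q \<in> mon_ideal V A"
  unfolding mon_ideal_def
proof (intro CollectI conjI ballI)
  show "p * q \<in> carrier (poly_ring V)"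
    using p q mon_ideal_subset_carrier by (intro mult_in_carrier_poly_ring) blast+
  fix m assume "m \<in> Poly_Mapping.keys (p * q)"
  then obtain x y where xy: "m = x + y" "x \<in> Poly_Mapping.keys p" by (rule keys_multE)
  obtain a d where "a \<in> A" "x = a + d" using p xy(2) by (rule mon_idealE)
  then have "a \<in> A" "m = a + (d + y)" by (simp_all add: xy(1) add.assoc)
  then show "\<exists>a\<in>A. \<exists>d. m = a + d" by blast
qed

lemma mon_ideal_mult:
  assumes p: "p \<in> mon_ideal V A" and q: "q \<in> mon_ideal V B"
  shows "p * q \<in> mon_ideal V {a + b | a b. a \<in> A \<and> b \<in> B}"
  unfolding mon_ideal_def
proof (intro CollectI conjI ballI)
  show "p * q \<in> carrier (poly_ring V)"
    using p q mon_ideal_subset_carrier by (intro mult_in_carrier_poly_ring) blast+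
  fix m assume "m \<in> Poly_Mapping.keys (p * q)"
  then obtain x y where xy: "m = x + y" "x \<in> Poly_Mapping.keys p" "y \<in> Poly_Mapping.keys q"
    by (rule keys_multE)
  obtain a d where a: "a \<in> A" "x = a + d" using p xy(2) by (rule mon_idealE)
  obtain b e where b: "b \<in> B" "y = b + e" using q xy(3) by (rule mon_idealE)
  have "m = (a + b) + (d + e)" using xy(1) a(2) b(2) by (simp add: ac_simps)
  then show "\<exists>c\<in>{a + b | a b. a \<in> A \<and> b \<in> B}. \<exists>d. m = c + d" using a(1) b(1) by blast
qed

lemma ideal_mon_ideal: "ideal (mon_ideal V A) (poly_ring V :: (('v \<Rightarrow>\<^sub>0 nat) \<Rightarrow>\<^sub>0 'k::field) ring)"
proof -
  interpret cring "poly_ring V :: (('v \<Rightarrow>\<^sub>0 nat) \<Rightarrow>\<^sub>0 'k) ring"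
    by (rule cring_poly_ring)
  let ?R = "poly_ring V :: (('v \<Rightarrow>\<^sub>0 nat) \<Rightarrow>\<^sub>0 'k) ring"
  have minus: "\<ominus>\<^bsub>?R\<^esub> p = - p" if p: "p \<in> carrier ?R" for p
  proof (rule minus_equality)
    show "- p \<in> carrier ?R" using p unfolding carrier_poly_ring keys_neg .
    show "- p \<oplus>\<^bsub>?R\<^esub> p = \<zero>\<^bsub>?R\<^esub>" unfolding poly_ring_def by simp
  qed (rule p)
  show ?thesis
  proof (rule idealI)
    show "subgroup (mon_ideal V A) (add_monoid ?R)"
    proof (rule add.subgroupI)
      show "mon_ideal V A \<subseteq> carrier ?R" by (auto simp: mon_ideal_def)
      have "0 \<in> (mon_ideal V A :: (('v \<Rightarrow>\<^sub>0 nat) \<Rightarrow>\<^sub>0 'k) set)" by (simp add: mon_ideal_def carrier_poly_ring)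
      then show "(mon_ideal V A :: (('v \<Rightarrow>\<^sub>0 nat) \<Rightarrow>\<^sub>0 'k) set) \<noteq> {}" by blast
    next
      fix p assume p: "p \<in> (mon_ideal V A :: (('v \<Rightarrow>\<^sub>0 nat) \<Rightarrow>\<^sub>0 'k) set)"
      then have "\<ominus>\<^bsub>?R\<^esub> p = - p" using minus by (simp add: mon_ideal_def)
      then show "\<ominus>\<^bsub>?R\<^esub> p \<in> mon_ideal V A"
        using p by (simp add: mon_ideal_def carrier_poly_ring keys_neg)
    next
      fix p q assume "p \<in> (mon_ideal V A :: (('v \<Rightarrow>\<^sub>0 nat) \<Rightarrow>\<^sub>0 'k) set)" "q \<in> (mon_ideal V A :: (('v \<Rightarrow>\<^sub>0 nat) \<Rightarrow>\<^sub>0 'k) set)"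
      then have "p + q \<in> (mon_ideal V A :: (('v \<Rightarrow>\<^sub>0 nat) \<Rightarrow>\<^sub>0 'k) set)"
        using keys_add[of p q] unfolding mon_ideal_def carrier_poly_ring by blast
      then show "p \<oplus>\<^bsub>?R\<^esub> q \<in> mon_ideal V A"
        by (simp add: poly_ring_def)
    qed
    fix p q assume pq: "p \<in> (mon_ideal V A :: (('v \<Rightarrow>\<^sub>0 nat) \<Rightarrow>\<^sub>0 'k) set)" "q \<in> carrier ?R"
    then show "p \<otimes>\<^bsub>?R\<^esub> q \<in> mon_ideal V A" using mon_ideal_mult_closed[of p V A q] by (simp add: poly_ring_def)
    from mon_ideal_mult_closed[of p V A q] pq show "q \<otimes>\<^bsub>?R\<^esub> p \<in> mon_ideal V A"
      by (simp add: poly_ring_def mult.commute)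
  qed (rule ring_axioms)
qed

lemma additive_closure_single:
  fixes p :: "'a \<Rightarrow>\<^sub>0 'b::ab_group_add"
  assumes zero: "0 \<in> J" and add: "\<And>x y. x \<in> J \<Longrightarrow> y \<in> J \<Longrightarrow> x + y \<in> J"
    and single: "\<And>m. m \<in> Poly_Mapping.keys p \<Longrightarrow> Poly_Mapping.single m (Poly_Mapping.lookup p m) \<in> J"
  shows "p \<in> J"
proof -
  have "(\<Sum>m\<in>S. Poly_Mapping.single m (Poly_Mapping.lookup p m)) \<in> J"
    if "finite S" "S \<subseteq> Poly_Mapping.keys p" for S
    using that by (induction S rule: finite_induct) (auto intro: zero add single)
  moreover have "(\<Sum>m\<in>Poly_Mapping.keys p. Poly_Mapping.single m (Poly_Mapping.lookup p m)) = p"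
    by (rule poly_mapping_eqI)
      (auto simp: lookup_sum lookup_single when_def in_keys_iff)
  ultimately show ?thesis by (metis finite_keys order_refl)
qed

text \<open>A polynomial is the sum of its terms, and each term of an element of the monomial ideal is a multiple
  of a generator.\<close>

lemma mon_ideal_minimal:
  fixes J :: "(('v \<Rightarrow>\<^sub>0 nat) \<Rightarrow>\<^sub>0 'k::field) set"
  assumes J: "ideal J (poly_ring V)" and A: "\<And>a. a \<in> A \<Longrightarrow> Poly_Mapping.keys a \<subseteq> V \<Longrightarrow> monomial a \<in> J"
  shows "mon_ideal V A \<subseteq> J"
proof
  let ?R = "poly_ring V :: (('v \<Rightarrow>\<^sub>0 nat) \<Rightarrow>\<^sub>0 'k) ring"
  interpret ideal J ?R by (rule J)
  fix p :: "('v \<Rightarrow>\<^sub>0 nat) \<Rightarrow>\<^sub>0 'k" assume p: "p \<in> mon_ideal V A"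
  show "p \<in> J"
  proof (rule additive_closure_single)
    show "0 \<in> J" using additive_subgroup.zero_closed[OF is_additive_subgroup] by (simp add: poly_ring_def)
    show "x + y \<in> J" if "x \<in> J" "y \<in> J" for x y
      using additive_subgroup.a_closed[OF is_additive_subgroup that] by (simp add: poly_ring_def)
  next
    fix m assume m: "m \<in> Poly_Mapping.keys p"
    with p obtain a d where ad: "a \<in> A" "m = a + d" and "Poly_Mapping.keys m \<subseteq> V"
      by (auto simp: mon_ideal_def carrier_poly_ring)
    then have keys: "Poly_Mapping.keys a \<subseteq> V" "Poly_Mapping.keys d \<subseteq> V"
      by (simp_all add: keys_add_nat)
    let ?q = "Poly_Mapping.single d (Poly_Mapping.lookup p m)"
    have "?q \<in> carrier ?R" using keys by (simp add: carrier_poly_ring)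
    from I_l_closed[OF A[OF ad(1) keys(1)] this] have "?q * monomial a \<in> J" by (simp add: poly_ring_def)
    moreover have "?q * monomial a = Poly_Mapping.single m (Poly_Mapping.lookup p m)"
      by (simp add: monomial_def mult_single ad add.commute)
    ultimately show "Poly_Mapping.single m (Poly_Mapping.lookup p m) \<in> J" by simp
  qed
qed

lemma genideal_monomials:
  assumes "\<And>a. a \<in> A \<Longrightarrow> Poly_Mapping.keys a \<subseteq> V"
  shows "genideal (poly_ring V) (monomial ` A) = (mon_ideal V A :: (('v \<Rightarrow>\<^sub>0 nat) \<Rightarrow>\<^sub>0 'k::field) set)"
proof
  interpret cring "poly_ring V :: (('v \<Rightarrow>\<^sub>0 nat) \<Rightarrow>\<^sub>0 'k) ring"
    by (rule cring_poly_ring)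
  have sub: "monomial ` A \<subseteq> (mon_ideal V A :: (('v \<Rightarrow>\<^sub>0 nat) \<Rightarrow>\<^sub>0 'k) set)"
    using assms by (auto intro: monomial_self_in_mon_ideal)
  then show "genideal (poly_ring V) (monomial ` A) \<subseteq> (mon_ideal V A :: (('v \<Rightarrow>\<^sub>0 nat) \<Rightarrow>\<^sub>0 'k) set)"
    by (rule genideal_minimal[OF ideal_mon_ideal])
  have "monomial ` A \<subseteq> carrier (poly_ring V :: (('v \<Rightarrow>\<^sub>0 nat) \<Rightarrow>\<^sub>0 'k) ring)"
    using sub by (auto simp: mon_ideal_def)
  then show "mon_ideal V A \<subseteq> genideal (poly_ring V :: (('v \<Rightarrow>\<^sub>0 nat) \<Rightarrow>\<^sub>0 'k) ring) (monomial ` A)"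
    by (intro mon_ideal_minimal genideal_ideal) (use genideal_self in blast)+
qed

lemma ideal_prod_mon_ideal:
  "ideal_prod (poly_ring V) (mon_ideal V A) (mon_ideal V B) =
    (mon_ideal V {a + b | a b. a \<in> A \<and> b \<in> B} :: (('v \<Rightarrow>\<^sub>0 nat) \<Rightarrow>\<^sub>0 'k::field) set)"
  (is "?P = mon_ideal V ?C")
proof
  let ?R = "poly_ring V :: (('v \<Rightarrow>\<^sub>0 nat) \<Rightarrow>\<^sub>0 'k) ring"
  interpret cring ?R by (rule cring_poly_ring)
  interpret C: ideal "mon_ideal V ?C" ?R by (rule ideal_mon_ideal)
  show "?P \<subseteq> mon_ideal V ?C"
  proof
    fix s assume "s \<in> ?P"
    then show "s \<in> mon_ideal V ?C"
    proof induction
      case (prod p q)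
      then show ?case using mon_ideal_mult[of p V A q B] by (simp add: poly_ring_def)
    next
      case (sum s1 s2)
      then show ?case
        by (intro additive_subgroup.a_closed[OF C.is_additive_subgroup])
    qed
  qed
  show "mon_ideal V ?C \<subseteq> ?P"
  proof (rule mon_ideal_minimal)
    show "ideal ?P ?R" by (intro ideal_prod_is_ideal ideal_mon_ideal)
    fix c assume "c \<in> ?C" "Poly_Mapping.keys c \<subseteq> V"
    then obtain a b where ab: "a \<in> A" "b \<in> B" "c = a + b" "Poly_Mapping.keys a \<subseteq> V" "Poly_Mapping.keys b \<subseteq> V"
      by (auto simp: keys_add_nat)
    then have "monomial a \<in> (mon_ideal V A :: (('v \<Rightarrow>\<^sub>0 nat) \<Rightarrow>\<^sub>0 'k) set)"
      "monomial b \<in> (mon_ideal V B :: (('v \<Rightarrow>\<^sub>0 nat) \<Rightarrow>\<^sub>0 'k) set)"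
      by (auto intro: monomial_self_in_mon_ideal)
    from ideal_prod.prod[OF this, of ?R] show "monomial c \<in> ?P"
      by (simp add: poly_ring_def monomial_mult ab)
  qed
qed

text \<open>A set of monomials that generates the ideal must contain every generator from an antichain \<open>B\<close>: an
  element of \<open>B\<close> is divisible by one of these monomials, which in turn is divisible by an element of
  \<open>B\<close>, and in an antichain this forces all three to be equal. This gives existence and uniqueness of
  the minimal generating set at once.\<close>

lemma minimal_monomial_generators_mon_ideal:
  fixes W :: "(('v \<Rightarrow>\<^sub>0 nat) \<Rightarrow>\<^sub>0 'k::field) set"
  assumes keys: "\<And>b. b \<in> B \<Longrightarrow> Poly_Mapping.keys b \<subseteq> V"
    and antichain: "\<And>a b d. a \<in> B \<Longrightarrow> b \<in> B \<Longrightarrow> b = a + d \<Longrightarrow> a = b"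
  shows "minimal_monomial_generators V (mon_ideal V B) W \<longleftrightarrow> W = monomial ` B"
proof -
  have super: "monomial ` B \<subseteq> W'"
    if W': "W' \<subseteq> monomials V" "genideal (poly_ring V) W' = mon_ideal V B"
    for W' :: "(('v \<Rightarrow>\<^sub>0 nat) \<Rightarrow>\<^sub>0 'k) set"
  proof -
    define C where "C = {a. monomial a \<in> W'}"
    have W'C: "W' = monomial ` C" using W'(1) by (auto simp: C_def monomials_def)
    have "Poly_Mapping.keys a \<subseteq> V" if "a \<in> C" for a
    proof -
      have "monomial a \<in> (monomials V :: (('v \<Rightarrow>\<^sub>0 nat) \<Rightarrow>\<^sub>0 'k) set)"
        using that W'(1) by (auto simp: C_def)
      then show ?thesis by (auto simp: monomials_def)
    qed
    then have CB: "mon_ideal V C = (mon_ideal V B :: (('v \<Rightarrow>\<^sub>0 nat) \<Rightarrow>\<^sub>0 'k) set)"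
      and keysC: "\<And>a. a \<in> C \<Longrightarrow> Poly_Mapping.keys a \<subseteq> V"
      using genideal_monomials[of C V] W' W'C by auto
    have "b \<in> C" if b: "b \<in> B" for b
    proof -
      have "monomial b \<in> (mon_ideal V C :: (('v \<Rightarrow>\<^sub>0 nat) \<Rightarrow>\<^sub>0 'k) set)"
        using b keys[OF b] unfolding CB by (rule monomial_self_in_mon_ideal)
      then obtain c d where c: "c \<in> C" "b = c + d" by (auto simp: monomial_in_mon_ideal)
      then have "monomial c \<in> (mon_ideal V B :: (('v \<Rightarrow>\<^sub>0 nat) \<Rightarrow>\<^sub>0 'k) set)"
        using keysC unfolding CB[symmetric] by (intro monomial_self_in_mon_ideal)
      then obtain b' d' where b': "b' \<in> B" "c = b' + d'" by (auto simp: monomial_in_mon_ideal)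
      have sum: "b = b' + (d' + d)" unfolding c(2) b'(2) by (rule add.assoc)
      have "b' = b" by (rule antichain[OF b'(1) b sum])
      with sum have "b + 0 = b + (d' + d)" by simp
      then have "d' + d = 0" by (metis add_left_imp_eq)
      then have "d = 0" 
        by (simp add: poly_mapping_eq_iff fun_eq_iff lookup_add)
      with c show ?thesis by simp
    qed
    then show ?thesis by (auto simp: W'C)
  qed
  have gen: "genideal (poly_ring V) (monomial ` B) = (mon_ideal V B :: (('v \<Rightarrow>\<^sub>0 nat) \<Rightarrow>\<^sub>0 'k) set)"
    by (rule genideal_monomials) (rule keys)
  have mon: "monomial ` B \<subseteq> monomials V"
    using keys by (auto simp: monomials_def)
  show ?thesis
  proof
    assume "minimal_monomial_generators V (mon_ideal V B) W"
    then have W: "W \<subseteq> monomials V" "genideal (poly_ring V) W = mon_ideal V B"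
      "\<And>W'. W' \<subset> W \<Longrightarrow> genideal (poly_ring V) W' \<noteq> mon_ideal V B"
      unfolding minimal_monomial_generators_def by simp_all
    have "monomial ` B \<subseteq> W" using W(1,2) by (rule super)
    moreover have "\<not> monomial ` B \<subset> W" using W(3)[of "monomial ` B"] gen by argo
    ultimately show "W = monomial ` B" by (simp add: psubset_eq)
  next
    assume W: "W = monomial ` B"
    show "minimal_monomial_generators V (mon_ideal V B) W"
      unfolding minimal_monomial_generators_def W
    proof (intro conjI allI impI)
      fix W' :: "(('v \<Rightarrow>\<^sub>0 nat) \<Rightarrow>\<^sub>0 'k) set"
      assume W': "W' \<subset> monomial ` B"
      show "genideal (poly_ring V) W' \<noteq> mon_ideal V B"
      proof
        assume "genideal (poly_ring V) W' = mon_ideal V B"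
        moreover have "W' \<subseteq> monomials V"
          using psubset_imp_subset[OF W'] mon by (rule subset_trans)
        ultimately have "monomial ` B \<subseteq> W'" by (intro super)
        with W' show False by (simp add: psubset_eq)
      qed
    qed (rule mon gen)+
  qed
qed

section \<open>Edge multisets and alternating walks\<close>

definition deg :: "'v set multiset \<Rightarrow> 'v \<Rightarrow> nat" where
  "deg M v = size (filter_mset (\<lambda>e. v \<in> e) M)"

lemma deg_empty [simp]: "deg {#} v = 0"
  and deg_add_mset [simp]: "deg (add_mset e M) v = deg M v + of_bool (v \<in> e)"
  and deg_union [simp]: "deg (M + N) v = deg M v + deg N v"
  by (simp_all add: deg_def)

lemma deg_mono_at:
  assumes "\<And>e. v \<in> e \<Longrightarrow> count M e \<le> count N e"
  shows "deg M v \<le> deg N v"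
  unfolding deg_def by (intro size_mset_mono) (simp add: subseteq_mset_def assms)

lemma deg_eq_sum_count:
  assumes "finite E" "set_mset M \<subseteq> E"
  shows "deg M v = (\<Sum>e | e \<in> E \<and> v \<in> e. count M e)"
proof -
  have "deg M v = (\<Sum>e\<in>set_mset (filter_mset (\<lambda>e. v \<in> e) M). count (filter_mset (\<lambda>e. v \<in> e) M) e)"
    by (simp add: deg_def size_multiset_overloaded_eq)
  also have "\<dots> = (\<Sum>e | e \<in> E \<and> v \<in> e. count M e)"
    using assms by (intro sum.mono_neutral_cong_left) (auto simp: not_in_iff)
  finally show ?thesis .
qed

lemma deg_posD: "0 < deg M v \<Longrightarrow> \<exists>e\<in>#M. v \<in> e"
  by (induction M) (auto simp: of_bool_def split: if_splits)

lemma sum_deg: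
  assumes "finite V" "\<And>e. e \<in># M \<Longrightarrow> e \<subseteq> V \<and> card e = 2"
  shows "(\<Sum>v\<in>V. deg M v) = 2 * size M"
  using assms(2)
proof (induction M)
  case (add e M)
  have "(\<Sum>v\<in>V. of_bool (v \<in> e) :: nat) = card e"
    using add.prems[of e] assms(1) by (simp add: Int_absorb1)
  then show ?case using add by (simp add: sum.distrib)
qed simp

lemma other_end:
  assumes "card e = 2" "v \<in> e"
  obtains u where "u \<noteq> v" "e = {v, u}"
proof -
  obtain a b where "e = {a, b}" "a \<noteq> b" using assms(1) by (auto simp: card_2_iff)
  with assms(2) that[of a] that[of b] show thesis by (auto simp: insert_commute)
qed

text \<open>If \<open>Y\<close> has larger degree than \<open>Z\<close> at \<open>x\<close>, follow a walk from \<open>x\<close> that alternately removes from \<open>Y\<close>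
  an edge that is in excess of \<open>Z\<close> and adds an edge in which \<open>Z\<close> is in excess. After an addition the
  walk stops when it reaches a vertex \<open>v\<close> at which \<open>Y\<close> has the smaller degree; then one unit of degree
  has moved from \<open>x\<close> to \<open>v\<close>. It can get stuck only after a removal; then \<open>Y\<close> has lost one edge and
  one unit of degree at each end of the walk, \<open>x\<close> and \<open>v\<close>, and the complementary multiset \<open>Z'\<close> has gained one, still without
  exceeding the degrees of \<open>Y\<close> at \<open>x\<close> and \<open>v\<close>. The complement \<open>Z'\<close> is recorded in both outcomes, because
  it provides the dual exchange.\<close>

lemma alternating_walk:
  assumes card: "\<forall>e\<in>#Y + Z. card e = 2"
    and x: "deg Z x < deg Y x"
  obtains
    (shift) v Y' Z' where "deg Y v < deg Z v" "Y' + Z' = Y + Z" "size Y' = size Y"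
      "\<And>w. deg Y' w + of_bool (w = x) = deg Y w + of_bool (w = v)"
      "\<And>w. deg Z' w + of_bool (w = v) = deg Z w + of_bool (w = x)"
  | (augment) v Y' Z' where "deg Z v + of_bool (v = x) < deg Y v" "Y' + Z' = Y + Z" "size Y' + 1 = size Y"
      "\<And>w. deg Y' w + of_bool (w = x) + of_bool (w = v) = deg Y w"
      "\<And>w. deg Z' w = deg Z w + of_bool (w = x) + of_bool (w = v)"
proof -
  \<comment> \<open>A longest walk is obtained as a multiset closest to \<open>Z\<close> among those whose degree vector is that of
    \<open>Y\<close> with one unit moved from \<open>x\<close>; the walk of length zero is \<open>Y\<close> itself, with \<open>v = x\<close>.\<close>
  define P where "P Y' \<longleftrightarrow> Y' \<subseteq># Y + Z \<and> size Y' = size Y \<and>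
    (\<exists>v. \<forall>w. deg Y' w + of_bool (w = x) = deg Y w + of_bool (w = v))" for Y'
  have "P Y" by (auto simp: P_def)
  then obtain Y' where Y': "P Y'" and min: "\<And>X. P X \<Longrightarrow> size (Y' - Z) \<le> size (X - Z)"
    using ex_has_least_nat[of P Y "\<lambda>X. size (X - Z)"] by blast
  then obtain v where sub: "Y' \<subseteq># Y + Z" and size: "size Y' = size Y"
    and v: "\<And>w. deg Y' w + of_bool (w = x) = deg Y w + of_bool (w = v)"
    by (auto simp: P_def)
  show thesis
  proof (cases "deg Y v < deg Z v")
    case True
    define Z' where "Z' = Y + Z - Y'"
    have sum: "Y' + Z' = Y + Z" using sub by (simp add: Z'_def)
    have "deg Z' w + of_bool (w = v) = deg Z w + of_bool (w = x)" for w
      using v[of w] arg_cong[OF sum, of "\<lambda>X. deg X w"] by simp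
    with True sum size v show thesis by (intro shift[of v Y' Z'])
  next
    case False
    with v[of v] x have "deg Z v < deg Y' v" by (auto split: if_splits simp: of_bool_def)
    then obtain e where e: "v \<in> e" "count Z e < count Y' e"
      using deg_mono_at[of v Y' Z] by (meson not_le)
    then have eY: "e \<in># Y'" by (metis count_inI less_nat_zero_code)
    then have "card e = 2" using sub card by (meson mset_subset_eqD)
    then obtain u where u: "u \<noteq> v" "e = {v, u}" using e(1) by (rule other_end)
    define Y1 where "Y1 = Y' - {#e#}"
    have Y1: "Y' = add_mset e Y1" using eY by (simp add: Y1_def)
    have degY1: "deg Y1 w + of_bool (w = x) + of_bool (w = u) = deg Y w" for w
      using v[of w] u by (auto simp: Y1 of_bool_def split: if_splits)
    have sub1: "Y1 \<subseteq># Y + Z" using sub subset_mset.order_trans[of Y1 Y'] by (simp add: Y1_def)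
    show thesis
    proof (cases "\<exists>f. u \<in> f \<and> count Y1 f < count Z f")
      case True
      then obtain f where f: "u \<in> f" "count Y1 f < count Z f" by blast
      have "f \<in># Z" using f(2) by (metis count_inI less_nat_zero_code)
      with card have "card f = 2" by simp
      then obtain t where t: "t \<noteq> u" "f = {u, t}" using f(1) by (rule other_end)
      have "P (add_mset f Y1)"
        unfolding P_def
      proof (intro conjI exI allI)
        show "add_mset f Y1 \<subseteq># Y + Z"
          using sub1 f(2) by (auto simp: subseteq_mset_def)
        show "size (add_mset f Y1) = size Y" using size Y1 by simp
        show "deg (add_mset f Y1) w + of_bool (w = x) = deg Y w + of_bool (w = t)" for w
          using degY1[of w] t by (auto simp: of_bool_def split: if_splits)
      qed
      from min[OF this] have "size (Y' - Z) \<le> size (add_mset f Y1 - Z)" .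
      moreover have "add_mset f Y1 - Z = Y1 - Z"
        using f(2) by (auto simp: multiset_eq_iff)
      moreover have "Y' - Z = add_mset e (Y1 - Z)"
        using e(2) by (auto simp: multiset_eq_iff Y1)
      ultimately show thesis by simp
    next
      case False
      then have "deg Z u \<le> deg Y1 u" by (intro deg_mono_at) (auto simp: not_less)
      then have less: "deg Z u + of_bool (u = x) < deg Y u" using degY1[of u] by simp
      define Z' where "Z' = Y + Z - Y1"
      have sum: "Y1 + Z' = Y + Z" using sub1 by (simp add: Z'_def)
      have "deg Z' w = deg Z w + of_bool (w = x) + of_bool (w = u)" for w
        using degY1[of w] arg_cong[OF sum, of "\<lambda>X. deg X w"] by simp
      moreover have "size Y1 + 1 = size Y" using size Y1 by simp
      ultimately show thesis using less sum degY1 by (intro augment[of u Y1 Z'])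
    qed
  qed
qed

section \<open>Maximum edge multisets under a degree bound\<close>

locale bounded_graph =
  fixes V :: "'v set" and E :: "'v set set" and c :: "'v \<Rightarrow> nat"
  assumes graph: "simple_graph V E"
begin

lemma finite_V: "finite V"
  and edge_subset: "e \<in> E \<Longrightarrow> e \<subseteq> V"
  and card_edge: "e \<in> E \<Longrightarrow> card e = 2"
  using graph by (auto simp: simple_graph_def)

lemma finite_E: "finite E"
  by (rule finite_subset[of _ "Pow V"]) (use edge_subset finite_V in blast)+

definition bounded :: "'v set multiset \<Rightarrow> bool" where
  "bounded M \<longleftrightarrow> set_mset M \<subseteq> E \<and> (\<forall>v\<in>V. deg M v \<le> c v)"

definition maximum :: "'v set multiset \<Rightarrow> bool" where
  "maximum M \<longleftrightarrow> bounded M \<and> (\<forall>N. bounded N \<longrightarrow> size N \<le> size M)"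

lemma deg_posE: "bounded M \<Longrightarrow> 0 < deg M v \<Longrightarrow> v \<in> V"
  using deg_posD[of M v] edge_subset by (auto simp: bounded_def)

lemma maximumI: "maximum M \<Longrightarrow> bounded N \<Longrightarrow> size N = size M \<Longrightarrow> maximum N"
  by (simp add: maximum_def)

lemma maximum_no_augment: "maximum M \<Longrightarrow> bounded N \<Longrightarrow> size N \<noteq> size M + 1"
  by (auto simp: maximum_def)

lemma maximum_bounded: "maximum M \<Longrightarrow> bounded M"
  by (simp add: maximum_def)

text \<open>For maximum multisets the walk cannot get stuck, since \<open>Z'\<close> would then be a larger bounded multiset.\<close>

lemma exchange_both:
  assumes Y: "maximum Y" and Z: "maximum Z" and x: "deg Z x < deg Y x"
  obtains v Y' Z' where "deg Y v < deg Z v" "maximum Y'" "maximum Z'"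
    "\<And>w. deg Y' w + of_bool (w = x) = deg Y w + of_bool (w = v)"
    "\<And>w. deg Z' w + of_bool (w = v) = deg Z w + of_bool (w = x)"
proof -
  have E: "set_mset Y \<subseteq> E" "set_mset Z \<subseteq> E"
    and le: "\<And>v. v \<in> V \<Longrightarrow> deg Y v \<le> c v" "\<And>v. v \<in> V \<Longrightarrow> deg Z v \<le> c v"
    using Y Z by (auto simp: maximum_def bounded_def)
  have sub: "set_mset Y' \<subseteq> E" "set_mset Z' \<subseteq> E" if "Y' + Z' = Y + Z" for Y' Z'
    using arg_cong[OF that, of set_mset] E by auto
  have same: "size Y = size Z" using Y Z by (meson maximum_def le_antisym)
  have two: "\<forall>e\<in>#Y + Z. card e = 2" using E card_edge by auto
  show thesis
  proof (rule alternating_walk[OF two x], goal_cases shift augment)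
    case (shift v Y' Z')
    have "bounded Y'" unfolding bounded_def
    proof (intro conjI ballI)
      fix w assume "w \<in> V"
      then show "deg Y' w \<le> c w"
        using shift(1) shift(4)[of w] le[of w] by (auto simp: of_bool_def split: if_splits)
    qed (rule sub[OF shift(2)])
    moreover have "bounded Z'" unfolding bounded_def
    proof (intro conjI ballI)
      fix w assume "w \<in> V"
      then show "deg Z' w \<le> c w"
        using x shift(5)[of w] le[of w] by (auto simp: of_bool_def split: if_splits)
    qed (rule sub[OF shift(2)])
    moreover have "size Z' = size Z" using arg_cong[OF shift(2), of size] shift(3) by simp
    ultimately show thesis
      using Y Z shift by (intro that[of v Y' Z']) (auto intro: maximumI)
  next
    case (augment v Y' Z')
    have "bounded Z'" unfolding bounded_def
    proof (intro conjI ballI)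
      fix w assume "w \<in> V"
      then show "deg Z' w \<le> c w"
        using x augment(1) augment(5)[of w] le[of w] by (auto simp: of_bool_def split: if_splits)
    qed (rule sub[OF augment(2)])
    moreover have "size Z' = size Z + 1" using arg_cong[OF augment(2), of size] augment(3) same by simp
    ultimately show thesis using maximum_no_augment Z by blast
  qed
qed

lemma exchange_down:
  assumes "maximum Y" "maximum Z" "deg Z x < deg Y x"
  obtains v Y' where "deg Y v < deg Z v" "maximum Y'"
    "\<And>w. deg Y' w + of_bool (w = x) = deg Y w + of_bool (w = v)"
  using assms by (rule exchange_both) blast

lemma exchange_up:
  assumes "maximum Y" "maximum Z" "deg Y x < deg Z x"
  obtains v Y' where "deg Z v < deg Y v" "maximum Y'"
    "\<And>w. deg Y' w + of_bool (w = v) = deg Y w + of_bool (w = x)"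
  using assms(2,1,3) by (rule exchange_both) blast

definition slack :: "'v set multiset \<Rightarrow> 'v \<Rightarrow> bool" where
  "slack M v \<longleftrightarrow> v \<in> V \<and> deg M v < c v"

definition inessential :: "'v set" where
  "inessential = {v. \<exists>M. maximum M \<and> slack M v}"

definition rival :: "'v \<Rightarrow> 'v \<Rightarrow> bool" where
  "rival u v \<longleftrightarrow> (\<forall>M. maximum M \<longrightarrow> \<not> (slack M u \<and> slack M v))"

lemma adjacent_rival:
  assumes "{u, v} \<in> E" shows "rival u v"
  unfolding rival_def
proof (intro allI impI notI)
  fix M assume M: "maximum M" and s: "slack M u \<and> slack M v"
  have "bounded (add_mset {u, v} M)"
    unfolding bounded_def
  proof (intro conjI ballI)
    fix w assume "w \<in> V"
    then show "deg (add_mset {u, v} M) w \<le> c w"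
      using s maximum_bounded[OF M] by (auto simp: slack_def bounded_def of_bool_def)
  qed (use assms maximum_bounded[OF M] in \<open>auto simp: bounded_def\<close>)
  with M maximum_no_augment show False by fastforce
qed

text \<open>Gallai's argument. If a maximum \<open>Y\<close> leaves \<open>u\<close> and \<open>w\<close> unsaturated, it saturates \<open>v\<close>, so its degree at
  \<open>v\<close> exceeds that in a maximum \<open>Z\<close> which leaves \<open>v\<close> unsaturated. Moving one unit away from \<open>v\<close> frees
  \<open>v\<close> and can saturate only one of \<open>u\<close> and \<open>w\<close>, which contradicts one of the two hypotheses.\<close>

lemma rival_trans:
  assumes uv: "rival u v" and vw: "rival v w" and v: "v \<in> inessential" and "u \<noteq> w"
  shows "rival u w"
  unfolding rival_def
proof (intro allI impI notI)
  fix Y assume Y: "maximum Y" and s: "slack Y u \<and> slack Y w"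
  obtain Z where Z: "maximum Z" "slack Z v" using v by (auto simp: inessential_def)
  have "\<not> slack Y v" using uv Y s by (auto simp: rival_def)
  then have "deg Z v < deg Y v" using Z by (auto simp: slack_def)
  with Y Z(1) obtain r Y' where Y': "maximum Y'"
    and deg: "\<And>t. deg Y' t + of_bool (t = v) = deg Y t + of_bool (t = r)"
    and r: "deg Y r < deg Z r"
    by (rule exchange_down) blast
  have "r \<noteq> v" using r \<open>deg Z v < deg Y v\<close> by auto
  have "deg Y v \<le> c v" "v \<in> V" using Y Z by (auto simp: slack_def maximum_def bounded_def)
  then have "slack Y' v" using deg[of v] \<open>r \<noteq> v\<close> by (simp add: slack_def)
  moreover have "slack Y' u \<or> slack Y' w"
    using deg[of u] deg[of w] s \<open>u \<noteq> w\<close> by (auto simp: slack_def of_bool_def split: if_splits)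
  ultimately show False using uv vw Y' by (auto simp: rival_def)
qed

lemma less_imp_slack:
  assumes "maximum Y" "maximum Z" "deg Y v < deg Z v"
  shows "slack Y v"
  using assms deg_posE[of Z v] by (force simp: slack_def maximum_def bounded_def)

text \<open>The weak exchange moves one unit from \<open>x\<close> to some \<open>v\<close>. Since \<open>r\<close> was unsaturated and \<open>x\<close> becomes so,
  rivalry leaves only \<open>v = r\<close>.\<close>

lemma rival_exchange:
  assumes Y: "maximum Y" and Z: "maximum Z" and x: "deg Z x < deg Y x" and r: "deg Y r < deg Z r"
    and rival: "rival x r"
  shows "\<exists>Y'. maximum Y' \<and> (\<forall>w. deg Y' w + of_bool (w = x) = deg Y w + of_bool (w = r))"
proof -
  obtain v Y' where v: "deg Y v < deg Z v" and Y': "maximum Y'"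
    and deg: "\<And>w. deg Y' w + of_bool (w = x) = deg Y w + of_bool (w = v)"
    using Y Z x by (rule exchange_down) blast
  have "v = r"
  proof (rule ccontr)
    assume "v \<noteq> r"
    have "x \<noteq> v" using x v by auto
    have "x \<in> V" "deg Y x \<le> c x"
      using less_imp_slack[OF Z Y x] Y by (auto simp: slack_def maximum_def bounded_def)
    then have "slack Y' x" using deg[of x] \<open>x \<noteq> v\<close> by (simp add: slack_def)
    moreover have "slack Y' r"
      using less_imp_slack[OF Y Z r] deg[of r] \<open>v \<noteq> r\<close> by (auto simp: slack_def)
    ultimately show False using rival Y' by (auto simp: rival_def)
  qed
  with Y' deg show ?thesis by blast
qed

text \<open>When the exchange between \<open>x\<close> and \<open>r\<close> is impossible, the weak exchange that starts from \<open>x\<close> ends in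
  another \<open>r'\<close>, and the one that ends in \<open>r\<close> starts from another \<open>x'\<close>. The vertices \<open>x\<close>, \<open>x'\<close> differ
  from \<open>r\<close>, \<open>r'\<close> because the sign of the difference of the degree vectors does.\<close>

lemma four_inessential_exchange:
  assumes Y: "maximum Y" and Z: "maximum Z" and x: "deg Z x < deg Y x" and r: "deg Y r < deg Z r"
    and no: "\<nexists>Y'. maximum Y' \<and> (\<forall>w. deg Y' w + of_bool (w = x) = deg Y w + of_bool (w = r))"
  shows "\<exists>S \<subseteq> inessential. card S = 4"
proof -
  obtain r' where r': "deg Y r' < deg Z r'" "r' \<noteq> r"
    using Y Z x by (rule exchange_down) (use no in blast)
  obtain x' where x': "deg Z x' < deg Y x'" "x' \<noteq> x"
    using Y Z r by (rule exchange_up) (use no in blast)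
  have "card {x, x', r, r'} = 4"
    using x r x' r' by (auto simp: card_insert_if)
  moreover have "{x, x', r, r'} \<subseteq> inessential"
    using less_imp_slack Y Z x r x' r' unfolding inessential_def by blast
  ultimately show ?thesis by blast
qed

end

section \<open>The generators as degree vectors\<close>

lemma genideal_eq_mon_ideal_cofinal:
  assumes keys: "\<And>a. a \<in> C \<Longrightarrow> Poly_Mapping.keys a \<subseteq> V" and sub: "B \<subseteq> C"
    and cofinal: "\<And>a. a \<in> C \<Longrightarrow> \<exists>b\<in>B. \<exists>d. a = b + d"
  shows "genideal (poly_ring V) (monomial ` C) = (mon_ideal V B :: (('v \<Rightarrow>\<^sub>0 nat) \<Rightarrow>\<^sub>0 'k::field) set)"
proof -
  have "genideal (poly_ring V) (monomial ` C) = (mon_ideal V C :: (('v \<Rightarrow>\<^sub>0 nat) \<Rightarrow>\<^sub>0 'k) set)"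
    using keys by (rule genideal_monomials)
  also have "\<dots> = mon_ideal V B"
  proof
    show "mon_ideal V C \<subseteq> (mon_ideal V B :: (('v \<Rightarrow>\<^sub>0 nat) \<Rightarrow>\<^sub>0 'k) set)"
      using ideal_mon_ideal by (rule mon_ideal_minimal) (use cofinal in \<open>auto simp: monomial_in_mon_ideal\<close>)
    show "mon_ideal V B \<subseteq> (mon_ideal V C :: (('v \<Rightarrow>\<^sub>0 nat) \<Rightarrow>\<^sub>0 'k) set)"
      using ideal_mon_ideal by (rule mon_ideal_minimal) (use sub in \<open>auto intro: monomial_self_in_mon_ideal\<close>)
  qed
  finally show ?thesis .
qed

text \<open>The exponent vector of the product of the edges in \<open>M\<close>; its entries are the degrees in \<open>M\<close>
  (\<open>lookup_expo\<close>).\<close>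

definition expo :: "'v set multiset \<Rightarrow> 'v \<Rightarrow>\<^sub>0 nat" where
  "expo M = (\<Sum>e\<in>#M. \<Sum>v\<in>e. Poly_Mapping.single v 1)"

lemma expo_empty [simp]: "expo {#} = 0"
  and expo_add_mset [simp]: "expo (add_mset e M) = (\<Sum>v\<in>e. Poly_Mapping.single v 1) + expo M"
  by (simp_all add: expo_def)

context bounded_graph
begin

lemma finite_edge: "e \<in> E \<Longrightarrow> finite e"
  using edge_subset finite_V finite_subset by blast

lemma lookup_expo:
  assumes "set_mset M \<subseteq> E"
  shows "Poly_Mapping.lookup (expo M) v = deg M v"
  using assms
proof (induction M)
  case (add e M)
  then have "finite e" using finite_edge by simp
  then show ?case using add
    by (auto simp: lookup_add lookup_sum lookup_single when_def of_bool_def)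
qed simp

lemma keys_expo:
  assumes "set_mset M \<subseteq> E" shows "Poly_Mapping.keys (expo M) \<subseteq> V"
proof
  fix v assume "v \<in> Poly_Mapping.keys (expo M)"
  then have "0 < deg M v" using lookup_expo[OF assms, of v] by (simp add: in_keys_iff del: lookup_not_eq_zero_eq_in_keys)
  then show "v \<in> V" using deg_posD[of M v] assms edge_subset by blast
qed

definition edge_products :: "nat \<Rightarrow> ('v \<Rightarrow>\<^sub>0 nat) set" where
  "edge_products q = {expo M | M. set_mset M \<subseteq> E \<and> size M = q}"

definition bounded_products :: "nat \<Rightarrow> ('v \<Rightarrow>\<^sub>0 nat) set" where
  "bounded_products q = {expo M | M. bounded M \<and> size M = q}"

lemma keys_edge_products: "a \<in> edge_products q \<Longrightarrow> Poly_Mapping.keys a \<subseteq> V"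
  using keys_expo by (auto simp: edge_products_def)

lemma edge_products_Suc:
  "edge_products (Suc q) = {a + b | a b. a \<in> edge_products q \<and> b \<in> edge_products 1}"
proof (intro equalityI subsetI)
  fix x assume "x \<in> edge_products (Suc q)"
  then obtain M where M: "x = expo M" "set_mset M \<subseteq> E" "size M = Suc q"
    by (auto simp: edge_products_def)
  then obtain e N where N: "M = add_mset e N" by (metis size_eq_Suc_imp_eq_union)
  then have "x = expo N + expo {#e#}" "set_mset N \<subseteq> E" "size N = q" "set_mset {#e#} \<subseteq> E" "size {#e#} = 1"
    using M by (simp_all add: add.commute)
  then show "x \<in> {a + b | a b. a \<in> edge_products q \<and> b \<in> edge_products 1}"
    unfolding edge_products_def by blast
next
  fix x assume "x \<in> {a + b | a b. a \<in> edge_products q \<and> b \<in> edge_products 1}"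
  then obtain M N where MN: "x = expo M + expo N" "set_mset M \<subseteq> E" "size M = q" "set_mset N \<subseteq> E" "size N = 1"
    unfolding edge_products_def by blast
  then have "x = expo (M + N)" "set_mset (M + N) \<subseteq> E" "size (M + N) = Suc q"
    by (simp_all add: expo_def)
  then show "x \<in> edge_products (Suc q)" unfolding edge_products_def by blast
qed

lemma edge_ideal_eq: "edge_ideal V E = (mon_ideal V (edge_products 1) :: (('v \<Rightarrow>\<^sub>0 nat) \<Rightarrow>\<^sub>0 'k::field) set)"
proof -
  have pair: "expo {#{u, v}#} = Poly_Mapping.single u 1 + Poly_Mapping.single v 1" if "{u, v} \<in> E" for u v
  proof -
    have "u \<noteq> v" using card_edge[OF that] by auto
    then show ?thesis by simp
  qed
  have "{var u * var v | u v. {u, v} \<in> E} = (monomial ` edge_products 1 :: (('v \<Rightarrow>\<^sub>0 nat) \<Rightarrow>\<^sub>0 'k) set)"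
  proof (intro equalityI subsetI)
    fix p :: "('v \<Rightarrow>\<^sub>0 nat) \<Rightarrow>\<^sub>0 'k" assume "p \<in> {var u * var v | u v. {u, v} \<in> E}"
    then obtain u v where uv: "p = var u * var v" "{u, v} \<in> E" by blast
    then have "p = monomial (expo {#{u, v}#})" by (simp only: pair var_def monomial_mult)
    moreover have "expo {#{u, v}#} \<in> edge_products 1" 
      using uv(2) unfolding edge_products_def by (intro CollectI exI[of _ "{#{u, v}#}"]) simp
    ultimately show "p \<in> monomial ` edge_products 1" by blast
  next
    fix p :: "('v \<Rightarrow>\<^sub>0 nat) \<Rightarrow>\<^sub>0 'k" assume "p \<in> monomial ` edge_products 1"
    then obtain M where M: "p = monomial (expo M)" "set_mset M \<subseteq> E" "size M = 1"
      by (auto simp: edge_products_def)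
    then obtain e where "M = {#e#}" using size_1_singleton_mset by blast
    with M(2) have e: "M = {#e#}" "e \<in> E" by simp_all
    then obtain u v where "e = {u, v}" using card_edge[OF e(2)] by (auto simp: card_2_iff)
    then have "p = var u * var v" "{u, v} \<in> E" using M e by (simp_all only: pair var_def monomial_mult)
    then show "p \<in> {var u * var v | u v. {u, v} \<in> E}" by blast
  qed
  then show ?thesis
    unfolding edge_ideal_def by (simp only: genideal_monomials keys_edge_products)
qed

lemma ideal_power_eq:
  "ideal_power V (edge_ideal V E) q = (mon_ideal V (edge_products q) :: (('v \<Rightarrow>\<^sub>0 nat) \<Rightarrow>\<^sub>0 'k::field) set)"
proof (induction q)
  case 0
  have "edge_products 0 = {0}" by (auto simp: edge_products_def)
  then show ?case
    by (auto simp: ideal_power_def nat_pow_def ideals_set_def mon_ideal_def)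
next
  case (Suc q)
  have "ideal_power V (edge_ideal V E) (Suc q) =
    ideal_prod (poly_ring V) (ideal_power V (edge_ideal V E) q) (edge_ideal V E :: (('v \<Rightarrow>\<^sub>0 nat) \<Rightarrow>\<^sub>0 'k) set)"
    by (simp add: ideal_power_def nat_pow_def ideals_set_def)
  also have "\<dots> = ideal_prod (poly_ring V) (mon_ideal V (edge_products q)) (mon_ideal V (edge_products 1))"
    unfolding Suc.IH by (simp only: edge_ideal_eq)
  finally show ?case by (simp only: ideal_prod_mon_ideal edge_products_Suc)
qed

text \<open>Every monomial of the power that obeys the bound is a multiple of a product of \<open>q\<close> edges, and this
  divisor obeys the bound as well.\<close>

lemma restrict_ideal_power:
  "restrict_ideal V c (ideal_power V (edge_ideal V E) q) =
    (mon_ideal V (bounded_products q) :: (('v \<Rightarrow>\<^sub>0 nat) \<Rightarrow>\<^sub>0 'k::field) set)"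
proof -
  let ?C = "{a. monomial a \<in> (mon_ideal V (edge_products q) :: (('v \<Rightarrow>\<^sub>0 nat) \<Rightarrow>\<^sub>0 'k) set)
    \<and> Poly_Mapping.keys a \<subseteq> V \<and> (\<forall>v\<in>V. Poly_Mapping.lookup a v \<le> c v)}"
  have "restrict_ideal V c (ideal_power V (edge_ideal V E) q) =
     genideal (poly_ring V) (monomial ` ?C :: (('v \<Rightarrow>\<^sub>0 nat) \<Rightarrow>\<^sub>0 'k) set)"
    unfolding restrict_ideal_def ideal_power_eq by (rule arg_cong[of _ _ "genideal (poly_ring V)"]) blast
  also have "\<dots> = mon_ideal V (bounded_products q)"
  proof (rule genideal_eq_mon_ideal_cofinal)
    show "bounded_products q \<subseteq> ?C"
    proof
      fix a assume "a \<in> bounded_products q"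
      then obtain M where M: "a = expo M" "bounded M" "size M = q" by (auto simp: bounded_products_def)
      then have E: "set_mset M \<subseteq> E" by (simp add: bounded_def)
      have "a \<in> edge_products q" using M E by (auto simp: edge_products_def)
      moreover have "Poly_Mapping.keys a \<subseteq> V" using keys_expo[OF E] M by simp
      ultimately show "a \<in> ?C"
        using M E by (auto simp: bounded_def lookup_expo intro: monomial_self_in_mon_ideal)
    qed
    fix a assume a: "a \<in> ?C"
    then obtain b d where "b \<in> edge_products q" and d: "a = b + d" by (auto simp: monomial_in_mon_ideal)
    then obtain M where M: "b = expo M" "set_mset M \<subseteq> E" "size M = q" by (auto simp: edge_products_def)
    have "bounded M"
      unfolding bounded_def
    proof (intro conjI ballI)
      fix v assume "v \<in> V"
      then have "Poly_Mapping.lookup (b + d) v \<le> c v" using a unfolding d by blast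
      then show "deg M v \<le> c v" using M by (simp add: lookup_add lookup_expo)
    qed (rule M)
    then have "b \<in> bounded_products q" using M by (auto simp: bounded_products_def)
    with d show "\<exists>b\<in>bounded_products q. \<exists>d. a = b + d" by blast
  qed blast
  finally show ?thesis .
qed

lemma mon_ideal_eq_zero_iff:
  assumes "\<And>a. a \<in> A \<Longrightarrow> Poly_Mapping.keys a \<subseteq> V"
  shows "mon_ideal V A = ({0} :: (('v \<Rightarrow>\<^sub>0 nat) \<Rightarrow>\<^sub>0 'k::field) set) \<longleftrightarrow> A = {}"
proof
  assume eq: "mon_ideal V A = ({0} :: (('v \<Rightarrow>\<^sub>0 nat) \<Rightarrow>\<^sub>0 'k) set)"
  show "A = {}"
  proof (rule ccontr)
    assume "A \<noteq> {}"
    then obtain a where "a \<in> A" by blast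
    with assms have "monomial a \<in> (mon_ideal V A :: (('v \<Rightarrow>\<^sub>0 nat) \<Rightarrow>\<^sub>0 'k) set)"
      by (intro monomial_self_in_mon_ideal)
    then have "monomial a = (0 :: ('v \<Rightarrow>\<^sub>0 nat) \<Rightarrow>\<^sub>0 'k)" unfolding eq by blast
    then have "Poly_Mapping.keys (monomial a :: ('v \<Rightarrow>\<^sub>0 nat) \<Rightarrow>\<^sub>0 'k) = {}" by simp
    then show False by simp
  qed
next
  assume "A = {}"
  then show "mon_ideal V A = ({0} :: (('v \<Rightarrow>\<^sub>0 nat) \<Rightarrow>\<^sub>0 'k) set)"
    by (auto simp: mon_ideal_def carrier_poly_ring)
qed

lemma sum_deg_bounded:
  assumes "bounded M" shows "(\<Sum>v\<in>V. deg M v) = 2 * size M"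
  using assms edge_subset card_edge by (intro sum_deg finite_V) (auto simp: bounded_def)

lemma size_bounded:
  assumes "bounded M" shows "size M \<le> sum c V"
proof -
  have "2 * size M \<le> sum c V"
    unfolding sum_deg_bounded[OF assms, symmetric]
    using assms by (intro sum_mono) (auto simp: bounded_def)
  then show ?thesis by simp
qed

lemma ex_maximum: "\<exists>M. maximum M"
proof -
  have "bounded {#}" by (simp add: bounded_def)
  then show ?thesis
    using ex_has_greatest_nat[of bounded "{#}" size "sum c V + 1"] size_bounded
    unfolding maximum_def by (metis less_Suc_eq_le Suc_eq_plus1)
qed

lemma delta_eq:
  assumes "maximum M"
  shows "delta V c (edge_ideal V E :: (('v \<Rightarrow>\<^sub>0 nat) \<Rightarrow>\<^sub>0 'k::field) set) = size M"
proof -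
  have keys: "Poly_Mapping.keys a \<subseteq> V" if "a \<in> bounded_products q" for a q
    using that keys_expo by (auto simp: bounded_products_def bounded_def)
  have zero: "mon_ideal V (bounded_products q) = ({0} :: (('v \<Rightarrow>\<^sub>0 nat) \<Rightarrow>\<^sub>0 'k) set) \<longleftrightarrow> bounded_products q = {}" for q
    by (rule mon_ideal_eq_zero_iff) (rule keys)
  have "restrict_ideal V c (ideal_power V (edge_ideal V E :: (('v \<Rightarrow>\<^sub>0 nat) \<Rightarrow>\<^sub>0 'k) set) q) \<noteq> {0}
    \<longleftrightarrow> (\<exists>N. bounded N \<and> size N = q)" for q
    unfolding restrict_ideal_power zero
    by (auto simp: bounded_products_def)
  then show ?thesis
    unfolding delta_def using assms by (intro Greatest_equality) (auto simp: maximum_def)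
qed

text \<open>The products are an antichain because, by the handshake identity \<open>sum_deg_bounded\<close>, they all have the
  same total degree; so none of them is superfluous.\<close>

lemma W_set_eq:
  "W_set V E c = (monomial ` {expo M | M. maximum M} :: (('v \<Rightarrow>\<^sub>0 nat) \<Rightarrow>\<^sub>0 'k::field) set)"
proof -
  obtain M0 where M0: "maximum M0" using ex_maximum by blast
  have B: "bounded_products (size M0) = {expo M | M. maximum M}"
  proof -
    have "bounded M \<and> size M = size M0 \<longleftrightarrow> maximum M" for M
    proof
      assume "bounded M \<and> size M = size M0"
      then show "maximum M" using maximumI[OF M0] by blast
    next
      assume M: "maximum M"
      have "size M \<le> size M0" "size M0 \<le> size M"
        using M M0 by (simp_all add: maximum_def)
      then show "bounded M \<and> size M = size M0" using M by (simp add: maximum_bounded)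
    qed
    then show ?thesis by (simp add: bounded_products_def)
  qed
  have "minimal_monomial_generators V (mon_ideal V (bounded_products (size M0))) W \<longleftrightarrow>
    W = monomial ` bounded_products (size M0)" for W :: "(('v \<Rightarrow>\<^sub>0 nat) \<Rightarrow>\<^sub>0 'k) set"
  proof (rule minimal_monomial_generators_mon_ideal)
    fix a assume "a \<in> bounded_products (size M0)"
    then show "Poly_Mapping.keys a \<subseteq> V"
      using keys_expo by (auto simp: bounded_products_def bounded_def)
  next
    fix a b d assume a: "a \<in> bounded_products (size M0)" and b: "b \<in> bounded_products (size M0)" and d: "b = a + d"
    obtain M where M: "a = expo M" "bounded M" "size M = size M0" using a by (auto simp: bounded_products_def)
    obtain N where N: "b = expo N" "bounded N" "size N = size M0" using b by (auto simp: bounded_products_def)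
    have lookup: "Poly_Mapping.lookup a v = deg M v" "Poly_Mapping.lookup b v = deg N v" for v
      using M N by (simp_all add: lookup_expo bounded_def)
    have le: "deg M v \<le> deg N v" for v
      unfolding lookup[symmetric] d by (simp add: lookup_add)
    have "(\<Sum>v\<in>V. deg M v) = (\<Sum>v\<in>V. deg N v)"
      using M N by (simp add: sum_deg_bounded)
    then have eq: "deg M v = deg N v" if "v \<in> V" for v
      using sum_mono_inv[of "deg M" V "deg N" v] le finite_V that by blast
    have "deg M v = deg N v" for v
      using eq[of v] deg_posE[OF N(2), of v] le[of v] by fastforce
    then show "a = b" by (intro poly_mapping_eqI) (simp add: lookup)
  qed
  then have "minimal_monomial_generators V (mon_ideal V (bounded_products (size M0))) =
    (\<lambda>W :: (('v \<Rightarrow>\<^sub>0 nat) \<Rightarrow>\<^sub>0 'k) set. W = monomial ` bounded_products (size M0))"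
    by (rule ext)
  then show ?thesis
    unfolding W_set_def Let_def delta_eq[OF M0] restrict_ideal_power B[symmetric] by simp
qed

text \<open>The exchange condition in terms of degrees. The unit lost at \<open>x\<close> is added on the other side of the
  equation in order to avoid truncated subtraction.\<close>

lemma strong_exchange_W_set:
  "strong_exchange V (W_set V E c :: (('v \<Rightarrow>\<^sub>0 nat) \<Rightarrow>\<^sub>0 'k::field) set) \<longleftrightarrow>
    (\<forall>Y Z. maximum Y \<longrightarrow> maximum Z \<longrightarrow> (\<forall>x\<in>V. \<forall>r\<in>V. deg Z x < deg Y x \<longrightarrow> deg Y r < deg Z r \<longrightarrow>
      (\<exists>Y'. maximum Y' \<and> (\<forall>w. deg Y' w + of_bool (w = x) = deg Y w + of_bool (w = r)))))"
proof -
  have mem: "monomial a \<in> (W_set V E c :: (('v \<Rightarrow>\<^sub>0 nat) \<Rightarrow>\<^sub>0 'k) set) \<longleftrightarrow> (\<exists>M. maximum M \<and> a = expo M)" for a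
    unfolding W_set_eq by auto
  have lookup: "Poly_Mapping.lookup (expo M) = deg M" if "maximum M" for M
    using that by (simp add: fun_eq_iff lookup_expo maximum_def bounded_def)
  have move: "var r * monomial (expo Y - Poly_Mapping.single x 1) \<in> (W_set V E c :: (('v \<Rightarrow>\<^sub>0 nat) \<Rightarrow>\<^sub>0 'k) set)
    \<longleftrightarrow> (\<exists>Y'. maximum Y' \<and> (\<forall>w. deg Y' w + of_bool (w = x) = deg Y w + of_bool (w = r)))"
    if Y: "maximum Y" and x: "0 < deg Y x" for Y x r
  proof -
    have eq: "Poly_Mapping.single r 1 + (expo Y - Poly_Mapping.single x 1) = expo Y' \<longleftrightarrow>
      (\<forall>w. deg Y' w + of_bool (w = x) = deg Y w + of_bool (w = r))" if Y': "maximum Y'" for Y'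
      unfolding poly_mapping_eq_iff fun_eq_iff
    proof (intro all_cong1)
      fix w show "Poly_Mapping.lookup (Poly_Mapping.single r 1 + (expo Y - Poly_Mapping.single x 1)) w =
          Poly_Mapping.lookup (expo Y') w \<longleftrightarrow>
        deg Y' w + of_bool (w = x) = deg Y w + of_bool (w = r)"
        using x by (auto simp: lookup[OF Y] lookup[OF Y'] lookup_add lookup_minus lookup_single when_def)
    qed
    show ?thesis unfolding var_def monomial_mult mem using eq by metis
  qed
  have "strong_exchange V (W_set V E c :: (('v \<Rightarrow>\<^sub>0 nat) \<Rightarrow>\<^sub>0 'k) set) \<longleftrightarrow>
    (\<forall>Y Z. maximum Y \<longrightarrow> maximum Z \<longrightarrow> (\<forall>x\<in>V. \<forall>r\<in>V. deg Z x < deg Y x \<longrightarrow> deg Y r < deg Z r \<longrightarrow>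
      var r * monomial (expo Y - Poly_Mapping.single x 1) \<in> (W_set V E c :: (('v \<Rightarrow>\<^sub>0 nat) \<Rightarrow>\<^sub>0 'k) set)))"
    unfolding strong_exchange_def
  proof (intro iffI allI impI ballI, goal_cases)
    case (1 Y Z x r)
    have "monomial (expo Y) \<in> (W_set V E c :: (('v \<Rightarrow>\<^sub>0 nat) \<Rightarrow>\<^sub>0 'k) set)"
      "monomial (expo Z) \<in> (W_set V E c :: (('v \<Rightarrow>\<^sub>0 nat) \<Rightarrow>\<^sub>0 'k) set)"
      using 1(2,3) mem by blast+
    from 1(1)[rule_format, OF this 1(4,5)] 1(6,7) show ?case
      unfolding lookup[OF 1(2)] lookup[OF 1(3)] by simp
  next
    case (2 a b x r)
    obtain Y Z where YZ: "maximum Y" "a = expo Y" "maximum Z" "b = expo Z"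
      using 2(2,3) mem by blast
    show ?case
      using 2(1)[rule_format, OF YZ(1,3) 2(4,5)] 2(6,7)
      unfolding YZ(2,4) lookup[OF YZ(1)] lookup[OF YZ(3)] by simp
  qed
  also have "\<dots> \<longleftrightarrow> (\<forall>Y Z. maximum Y \<longrightarrow> maximum Z \<longrightarrow> (\<forall>x\<in>V. \<forall>r\<in>V. deg Z x < deg Y x \<longrightarrow> deg Y r < deg Z r \<longrightarrow>
      (\<exists>Y'. maximum Y' \<and> (\<forall>w. deg Y' w + of_bool (w = x) = deg Y w + of_bool (w = r)))))"
  proof (intro iffI allI impI ballI, goal_cases)
    case (1 Y Z x r)
    from 1(1)[rule_format, OF 1(2-7)] move[OF 1(2), of x r] 1(6) show ?case by simp
  next
    case (2 Y Z x r)
    from 2(1)[rule_format, OF 2(2-7)] move[OF 2(2), of x r] 2(6) show ?case by simp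
  qed
  finally show ?thesis .
qed

end

section \<open>Cycles of length at most seven\<close>

locale cycle_graph = bounded_graph "cycle_verts n" "cycle_edges n" c for n c +
  assumes n3: "3 \<le> n"
begin

text \<open>The cycle is unrolled: \<open>vertex j\<close> and \<open>edge j\<close> depend only on \<open>j\<close> modulo \<open>n\<close>, and \<open>edge j\<close> joins
  \<open>vertex j\<close> to \<open>vertex (Suc j)\<close>. Arguments along the cycle then need no case distinction at the closing
  edge.\<close>

definition vertex :: "nat \<Rightarrow> nat" where "vertex j = j mod n + 1"
definition edge :: "nat \<Rightarrow> nat set" where "edge j = {vertex j, vertex (Suc j)}"

lemma vertex_in_verts: "vertex j \<in> cycle_verts n"
  using n3 by (simp add: vertex_def cycle_verts_def Suc_leI)

lemma vertex_pred: "v \<in> cycle_verts n \<Longrightarrow> vertex (v - 1) = v"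
  by (auto simp: vertex_def cycle_verts_def)

lemma vertex_add_eq_iff:
  assumes "a < n" "b < n" shows "vertex (j + a) = vertex (j + b) \<longleftrightarrow> a = b"
proof
  have less: False if "a < b" "b < n" "vertex (j + a) = vertex (j + b)" for a b
  proof -
    have "(j + b) mod n = (j + a) mod n" using that by (simp add: vertex_def)
    then have "n dvd (j + b) - (j + a)" using that by (subst (asm) mod_eq_dvd_iff_nat) auto
    then show False using that by (auto dest: dvd_imp_le)
  qed
  assume "vertex (j + a) = vertex (j + b)"
  then show "a = b" using less[of a b] less[of b a] assms by (metis linorder_neqE_nat)
qed simp

lemma vertex_Suc_eq_iff: "vertex (Suc i) = vertex (Suc j) \<longleftrightarrow> vertex i = vertex j"
  by (auto simp: vertex_def mod_Suc)

lemma edge_cong: "vertex i = vertex j \<Longrightarrow> edge i = edge j"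
  using vertex_Suc_eq_iff by (auto simp: edge_def)

lemma edge_Suc_neq: "edge j \<noteq> edge (Suc j)"
proof
  assume "edge j = edge (Suc j)"
  then have "vertex j = vertex (Suc j) \<or> vertex j = vertex (Suc (Suc j))" by (auto simp: edge_def doubleton_eq_iff)
  then show False using vertex_add_eq_iff[of 0 1 j] vertex_add_eq_iff[of 0 2 j] n3 by auto
qed

lemma cycle_edges_eq: "cycle_edges n = range edge"
proof (intro equalityI subsetI)
  fix e assume "e \<in> cycle_edges n"
  then consider i where "1 \<le> i" "i < n" "e = {i, i + 1}" | "e = {n, 1}"
    by (auto simp: cycle_edges_def)
  then have "\<exists>i. e = edge i"
  proof cases
    case (1 i)
    then show ?thesis by (intro exI[of _ "i - 1"]) (auto simp: edge_def vertex_def)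
  next
    case 2
    then show ?thesis using n3 by (intro exI[of _ "n - 1"]) (auto simp: edge_def vertex_def)
  qed
  then show "e \<in> range edge" by blast
next
  fix e assume "e \<in> range edge"
  then obtain j where j: "e = edge j" by blast
  show "e \<in> cycle_edges n"
  proof (cases "Suc (j mod n) = n")
    case True
    then have "e = {n, 1}" by (simp add: j edge_def vertex_def mod_Suc)
    then show ?thesis by (simp add: cycle_edges_def)
  next
    case False
    then have "e = {j mod n + 1, j mod n + 1 + 1}" by (simp add: j edge_def vertex_def mod_Suc)
    moreover have "j mod n + 1 < n" using False n3 by (metis Suc_eq_plus1 Suc_lessI mod_less_divisor less_le_trans zero_less_numeral)
    ultimately show ?thesis by (auto simp: cycle_edges_def)
  qed
qed

lemma deg_vertex_Suc:
  assumes "set_mset M \<subseteq> cycle_edges n"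
  shows "deg M (vertex (Suc j)) = count M (edge j) + count M (edge (Suc j))"
proof -
  have "{e. e \<in> cycle_edges n \<and> vertex (Suc j) \<in> e} = {edge j, edge (Suc j)}"
  proof (intro equalityI subsetI)
    fix e assume "e \<in> {e. e \<in> cycle_edges n \<and> vertex (Suc j) \<in> e}"
    then obtain k where k: "e = edge k" "vertex (Suc j) \<in> edge k" by (auto simp: cycle_edges_eq)
    then have "vertex k = vertex (Suc j) \<or> vertex k = vertex j" using vertex_Suc_eq_iff[of j k] by (auto simp: edge_def)
    then show "e \<in> {edge j, edge (Suc j)}" using edge_cong k by blast
  qed (auto simp: cycle_edges_eq edge_def)
  with deg_eq_sum_count[OF finite_E assms, of "vertex (Suc j)"] edge_Suc_neq[of j] show ?thesis
    by simp
qed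

text \<open>Let \<open>u\<close>, \<open>v\<close>, \<open>t\<close> be consecutive vertices, the first two inessential. There are a maximum \<open>Y\<close> that
  leaves \<open>u\<close> unsaturated and a maximum \<open>Y'\<close> whose degrees arise by moving one unit from \<open>v\<close> to \<open>u\<close>. The
  difference of their multiplicities alternates in sign along the path from \<open>v\<close> around the cycle to \<open>u\<close>,
  and the degree conditions at \<open>u\<close> and \<open>v\<close> then force it to be 1 on the edge \<open>vt\<close>. So \<open>Y\<close> contains
  \<open>vt\<close>, and replacing one copy of it by \<open>uv\<close> leaves \<open>t\<close> unsaturated.\<close>

lemma inessential_propagates:
  assumes u: "vertex j \<in> inessential" and v: "vertex (Suc j) \<in> inessential"
  shows "vertex (Suc (Suc j)) \<in> inessential"
proof -
  let ?u = "vertex j" and ?v = "vertex (Suc j)" and ?t = "vertex (Suc (Suc j))"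
  have neq: "?u \<noteq> ?v" "?u \<noteq> ?t" "?v \<noteq> ?t"
    using vertex_add_eq_iff[of 0 1 j] vertex_add_eq_iff[of 0 2 j] vertex_add_eq_iff[of 1 2 j] n3 by auto
  have rival: "rival ?u ?v"
    by (rule adjacent_rival) (auto simp: cycle_edges_eq edge_def)
  obtain Y where Y: "maximum Y" "slack Y ?u" using u by (auto simp: inessential_def)
  obtain Z where Z: "maximum Z" "slack Z ?v" using v by (auto simp: inessential_def)
  have "\<not> slack Y ?v" "\<not> slack Z ?u" using rival Y Z by (auto simp: rival_def)
  then have less: "deg Z ?v < deg Y ?v" "deg Y ?u < deg Z ?u" using Y Z by (auto simp: slack_def)
  have "rival ?v ?u" using rival by (auto simp: rival_def)
  then obtain Y' where Y': "maximum Y'"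
    and deg: "\<And>w. deg Y' w + of_bool (w = ?v) = deg Y w + of_bool (w = ?u)"
    using rival_exchange[OF Y(1) Z(1) less] by blast
  have E: "set_mset Y \<subseteq> cycle_edges n" "set_mset Y' \<subseteq> cycle_edges n"
    using Y Y' by (auto simp: maximum_def bounded_def)
  define d where "d k = int (count Y (edge (j + k))) - int (count Y' (edge (j + k)))" for k
  have d: "d k + d (Suc k) = of_bool (vertex (j + Suc k) = ?v) - of_bool (vertex (j + Suc k) = ?u)" for k
  proof -
    have "d k + d (Suc k) = int (deg Y (vertex (j + Suc k))) - int (deg Y' (vertex (j + Suc k)))"
      using deg_vertex_Suc[OF E(1), of "j + k"] deg_vertex_Suc[OF E(2), of "j + k"]
      unfolding d_def add_Suc_right by linarith
    moreover have "int (deg Y' w) + of_bool (w = ?v) = int (deg Y w) + of_bool (w = ?u)" for w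
      using arg_cong[OF deg[of w], of int] by (simp only: of_nat_add of_nat_of_bool)
    from this[of "vertex (j + Suc k)"]
    have "int (deg Y (vertex (j + Suc k))) - int (deg Y' (vertex (j + Suc k))) =
      of_bool (vertex (j + Suc k) = ?v) - of_bool (vertex (j + Suc k) = ?u)" by linarith
    ultimately show ?thesis by (rule trans)
  qed
  have alt: "d (Suc i) = d 1 \<or> d (Suc i) = - d 1" if "i + 2 \<le> n" for i
    using that
  proof (induction i)
    case (Suc i)
    then have "vertex (j + Suc (Suc i)) \<noteq> ?u" "vertex (j + Suc (Suc i)) \<noteq> ?v"
      using vertex_add_eq_iff[of "Suc (Suc i)" 0 j] vertex_add_eq_iff[of "Suc (Suc i)" 1 j] by auto
    with d[of "Suc i"] have "d (Suc (Suc i)) = - d (Suc i)" by simp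
    with Suc show ?case by auto
  qed simp
  have "d 0 + d 1 = 1" using d[of 0] neq by simp
  moreover have "d n = d 0"
    using edge_cong[of "j + n" j] by (simp add: d_def vertex_def)
  moreover have "d (n - 1) + d n = - 1"
    using d[of "n - 1"] neq n3 by (simp add: vertex_def)
  moreover have "d (n - 1) = d 1 \<or> d (n - 1) = - d 1"
    using alt[of "n - 2"] n3 by (simp add: numeral_2_eq_2 Suc_diff_Suc)
  ultimately have "d 1 = 1" by auto
  then have "edge (Suc j) \<in># Y" by (auto simp: d_def intro: count_inI)
  then obtain R where R: "Y = add_mset (edge (Suc j)) R" by (blast dest: multi_member_split)
  define N where "N = add_mset (edge j) R"
  have "bounded N"
    unfolding bounded_def
  proof (intro conjI ballI)
    show "set_mset N \<subseteq> cycle_edges n" using E(1) by (auto simp: N_def R cycle_edges_eq)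
    fix w assume "w \<in> cycle_verts n"
    then have "deg Y w \<le> c w" using Y by (simp add: maximum_def bounded_def)
    then show "deg N w \<le> c w"
      using Y(2) neq by (auto simp: N_def R edge_def slack_def of_bool_def split: if_splits)
  qed
  then have "maximum N" using maximumI[OF Y(1)] by (simp add: N_def R)
  moreover have "slack N ?t"
    using Y(1) vertex_in_verts[of "Suc (Suc j)"] neq
    by (auto simp: slack_def maximum_def bounded_def N_def R edge_def of_bool_def)
  ultimately show ?thesis by (auto simp: inessential_def)
qed

lemma adjacent_inessential_imp_all:
  assumes "vertex j \<in> inessential" "vertex (Suc j) \<in> inessential"
  shows "vertex i \<in> inessential"
proof -
  have "vertex (j + k) \<in> inessential \<and> vertex (j + Suc k) \<in> inessential" for k
  proof (induction k)
    case (Suc k)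
    then show ?case using inessential_propagates[of "j + k"] by simp
  qed (use assms in simp)
  \<comment> \<open>A multiple of \<open>n\<close> is added so that the walk from \<open>j\<close> to \<open>i\<close> goes forward also when \<open>i < j\<close>.\<close>
  from this[of "j * n - j + i"] have "vertex (j + (j * n - j + i)) \<in> inessential" by blast
  moreover have "j \<le> j * n" using n3 by simp
  then have "j + (j * n - j + i) = i + j * n" by linarith
  then have "vertex (j + (j * n - j + i)) = vertex i" by (simp only: vertex_def mod_mult_self1)
  ultimately show ?thesis by simp
qed

lemma all_rivals:
  assumes "\<And>i. vertex i \<in> inessential" "u \<in> cycle_verts n" "v \<in> cycle_verts n" "u \<noteq> v"
  shows "rival u v"
proof -
  have "k + 1 < n \<longrightarrow> rival (vertex j) (vertex (j + Suc k))" for j k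
  proof (induction k)
    case 0
    have "rival (vertex j) (vertex (Suc j))" by (rule adjacent_rival) (auto simp: cycle_edges_eq edge_def)
    then show ?case by simp
  next
    case (Suc k)
    have "rival (vertex (j + Suc k)) (vertex (j + Suc (Suc k)))" by (rule adjacent_rival) (auto simp: cycle_edges_eq edge_def)
    moreover have "vertex j \<noteq> vertex (j + Suc (Suc k))" if "Suc k + 1 < n"
      using vertex_add_eq_iff[of 0 "Suc (Suc k)" j] that by auto
    ultimately show ?case
      using Suc rival_trans[OF _ _ assms(1), of "vertex j" "j + Suc k"] by simp
  qed
  note rivals = this
  have "rival u v" if "u < v" "u \<in> cycle_verts n" "v \<in> cycle_verts n" for u v
  proof -
    have "vertex (u - 1) = u" "vertex (u - 1 + Suc (v - u - 1)) = v"
      using that by (auto simp: vertex_def cycle_verts_def)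
    then show ?thesis using rivals[of "v - u - 1" "u - 1"] that by (auto simp: cycle_verts_def)
  qed
  from this[of u v] this[of v u] assms(2-4) show ?thesis
    by (cases "u < v") (auto simp: rival_def)
qed

text \<open>An independent set is disjoint from its shift by one step. On vertices, which are numbered from 1, the
  map \<open>vertex\<close> is that shift.\<close>

lemma card_independent:
  assumes S: "S \<subseteq> cycle_verts n" and indep: "\<And>j. vertex j \<in> S \<Longrightarrow> vertex (Suc j) \<notin> S"
  shows "2 * card S \<le> n"
proof -
  have fin: "finite S" using S finite_V by (rule finite_subset)
  have disj: "S \<inter> vertex ` S = {}"
  proof (rule equals0I)
    fix w assume "w \<in> S \<inter> vertex ` S"
    then obtain v where v: "v \<in> S" "vertex v \<in> S" by blast
    have "Suc (v - 1) = v" using v S by (auto simp: cycle_verts_def)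
    then show False using indep[of "v - 1"] vertex_pred[of v] v S by auto
  qed
  have "inj_on vertex S"
  proof (rule inj_onI)
    fix v w assume vw: "v \<in> S" "w \<in> S" "vertex v = vertex w"
    have "Suc (v - 1) = v" "Suc (w - 1) = w" using vw S by (auto simp: cycle_verts_def)
    then have "vertex (v - 1) = vertex (w - 1)" using vertex_Suc_eq_iff[of "v - 1" "w - 1"] vw by simp
    then show "v = w" using vw S vertex_pred by (metis subsetD)
  qed
  then have "2 * card S = card (S \<union> vertex ` S)"
    using fin disj by (simp add: card_Un_disjoint card_image)
  also have "\<dots> \<le> card (cycle_verts n)"
    using S vertex_in_verts by (intro card_mono finite_V) auto
  finally show ?thesis by (simp add: cycle_verts_def)
qed

lemma short_cycle_exchange:
  assumes "n \<le> 7" and Y: "maximum Y" and Z: "maximum Z"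
    and x: "deg Z x < deg Y x" and r: "deg Y r < deg Z r"
  shows "\<exists>Y'. maximum Y' \<and> (\<forall>w. deg Y' w + of_bool (w = x) = deg Y w + of_bool (w = r))"
proof (cases "\<exists>j. vertex j \<in> inessential \<and> vertex (Suc j) \<in> inessential")
  case True
  then have all: "vertex i \<in> inessential" for i using adjacent_inessential_imp_all by blast
  have "x \<in> cycle_verts n" "r \<in> cycle_verts n" "x \<noteq> r"
    using deg_posE[OF maximum_bounded[OF Y], of x] deg_posE[OF maximum_bounded[OF Z], of r] x r by auto
  with all have "rival x r" by (intro all_rivals)
  with Y Z x r show ?thesis by (rule rival_exchange)
next
  case False
  show ?thesis
  proof (rule ccontr)
    assume "\<not> ?thesis"
    with four_inessential_exchange[OF Y Z x r] obtain S where S: "S \<subseteq> inessential" "card S = 4" by blast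
    then have "S \<subseteq> cycle_verts n" by (auto simp: inessential_def slack_def)
    moreover have "vertex (Suc j) \<notin> S" if "vertex j \<in> S" for j using that S(1) False by blast
    ultimately show False using card_independent[of S] S(2) \<open>n \<le> 7\<close> by simp
  qed
qed

end

section \<open>Cycles of length at least eight\<close>

text \<open>The easy half of the min-max duality: every edge of \<open>N\<close> is counted in the degree of some vertex of
  the cover.\<close>

lemma (in bounded_graph) cover_bounds_size:
  assumes "U \<subseteq> V" "\<And>e. e \<in> E \<Longrightarrow> e \<inter> U \<noteq> {}" "bounded N"
  shows "size N \<le> sum c U"
proof -
  have fin: "finite U" using assms(1) finite_V by (rule finite_subset)
  have "size N \<le> (\<Sum>v\<in>U. deg N v)" if "set_mset N \<subseteq> E" for N
    using that
  proof (induction N)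
    case (add e N)
    then have "0 < card (U \<inter> e)" using assms(2)[of e] fin by (auto simp: card_gt_0_iff)
    then have "1 \<le> (\<Sum>v\<in>U. of_bool (v \<in> e) :: nat)" using fin by simp
    then show ?case using add by (simp add: sum.distrib)
  qed simp
  also have "(\<Sum>v\<in>U. deg N v) \<le> sum c U"
    using assms by (intro sum_mono) (auto simp: bounded_def)
  finally show ?thesis using assms(3) by (simp add: bounded_def)
qed

definition long_bound :: "nat \<Rightarrow> nat \<Rightarrow> nat" where
  "long_bound n v = (if even v \<or> v = n then 1 else 2)"

text \<open>Each even vertex from 8 on is joined to its predecessor and, for odd \<open>n\<close>, the vertex \<open>n\<close> is joined to
  1. The two multisets compared below agree on this part and differ only on the path from 1 to 7.\<close>

definition long_tail :: "nat \<Rightarrow> nat set multiset" where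
  "long_tail n = image_mset (\<lambda>k. {2 * k - 1, 2 * k}) (mset_set {4..n div 2}) +
     (if odd n then {#{n, 1}#} else {#})"

lemma deg_long_tail:
  "deg (long_tail n) v = of_bool (7 \<le> v \<and> v \<le> 2 * (n div 2)) + of_bool (odd n \<and> (v = n \<or> v = 1))"
proof -
  have "{k \<in> {4..n div 2}. v \<in> {2 * k - 1, 2 * k}} =
    (if 7 \<le> v \<and> v \<le> 2 * (n div 2) then {(v + 1) div 2} else {})"
    by auto
  then have "card {k \<in> {4..n div 2}. v \<in> {2 * k - 1, 2 * k}} = of_bool (7 \<le> v \<and> v \<le> 2 * (n div 2))"
    by (simp split: if_splits)
  then show ?thesis
    by (simp add: long_tail_def deg_def filter_mset_image_mset)
qed

text \<open>Every edge of \<open>Y\<close> and of \<open>Z\<close> meets the cover \<open>?U\<close> in one vertex, and every vertex of the cover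
  lies on one edge of each, so both attain the bound of \<open>cover_bounds_size\<close>. Moving a unit from 1 to 5 in the degree vector of \<open>Y\<close> would give the vertices 5 and
  7 degree 2 each, while their only neighbours 4, 6 and 8 have degree 1.\<close>

lemma long_cycle_not_exchange:
  assumes n: "8 \<le> n"
  shows "\<not> graph_strong_exchange TYPE('k::field) (cycle_verts n) (cycle_edges n)"
proof
  assume exch: "graph_strong_exchange TYPE('k) (cycle_verts n) (cycle_edges n)"
  interpret bounded_graph "cycle_verts n" "cycle_edges n" "long_bound n"
    by unfold_locales (rule simple_graph_cycle, use n in simp)
  define Y where "Y = long_tail n + {#{1, 2}, {4, 5}, {6, 7}#}"
  define Z where "Z = long_tail n + {#{2, 3}, {4, 5}, {5, 6}#}"
  have step: "{i, Suc i} \<in> cycle_edges n" if "1 \<le> i" "i < n" for i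
    using that by (auto simp: cycle_edges_def)
  have tail: "set_mset (long_tail n) \<subseteq> cycle_edges n"
  proof
    fix e assume "e \<in># long_tail n"
    then consider k where "4 \<le> k" "k \<le> n div 2" "e = {2 * k - 1, 2 * k}" | "e = {n, 1}"
      by (auto simp: long_tail_def split: if_splits)
    then show "e \<in> cycle_edges n"
    proof cases
      case (1 k)
      then show ?thesis using step[of "2 * k - 1"] by auto
    qed (simp add: cycle_edges_def)
  qed
  have E: "set_mset Y \<subseteq> cycle_edges n" "set_mset Z \<subseteq> cycle_edges n"
    using tail n step[of 1] step[of 2] step[of 4] step[of 5] step[of 6]
    by (auto simp: Y_def Z_def numeral_eq_Suc)
  have degY: "deg Y v = deg (long_tail n) v +
      of_bool (v = 1 \<or> v = 2) + of_bool (v = 4 \<or> v = 5) + of_bool (v = 6 \<or> v = 7)" for v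
    by (simp add: Y_def)
  have degZ: "deg Z v = deg (long_tail n) v +
      of_bool (v = 2 \<or> v = 3) + of_bool (v = 4 \<or> v = 5) + of_bool (v = 5 \<or> v = 6)" for v
    by (simp add: Z_def)
  have "deg Y v \<le> long_bound n v \<and> deg Z v \<le> long_bound n v" if "v \<in> cycle_verts n" for v
  proof -
    have "1 \<le> v" using that by (simp add: cycle_verts_def)
    then have "v = 1 \<or> v = 2 \<or> v = 3 \<or> v = 4 \<or> v = 5 \<or> v = 6 \<or> v = 7 \<or> 8 \<le> v" by linarith
    then show ?thesis
      using n by (elim disjE) (auto simp: degY degZ deg_long_tail long_bound_def)
  qed
  then have bounded: "bounded Y" "bounded Z"
    using E by (simp_all add: bounded_def)
  let ?U = "(\<lambda>k. 2 * k) ` {1..n div 2} \<union> (if odd n then {n} else {})"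
  have "maximum M" if "bounded M" "size M = size (long_tail n) + 3" for M
    unfolding maximum_def
  proof (intro conjI allI impI that)
    fix N assume "bounded N"
    have "size N \<le> sum (long_bound n) ?U"
    proof (rule cover_bounds_size)
      show "?U \<subseteq> cycle_verts n" using n by (auto simp: cycle_verts_def)
      show "e \<inter> ?U \<noteq> {}" if e: "e \<in> cycle_edges n" for e
      proof -
        have U: "v \<in> ?U" if "1 \<le> v" "v \<le> n" "even v \<or> v = n" for v
          using that by (auto elim!: evenE)
        from e consider i where "1 \<le> i" "i < n" "e = {i, i + 1}" | "e = {n, 1}"
          by (auto simp: cycle_edges_def)
        then show ?thesis
        proof cases
          case (1 i)
          then show ?thesis using U[of i] U[of "i + 1"] by (cases "even i") auto
        next
          case 2
          then show ?thesis using U[of n] n by auto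
        qed
      qed
    qed (rule \<open>bounded N\<close>)
    also have "\<dots> = (\<Sum>v\<in>?U. 1)"
      by (rule sum.cong) (auto simp: long_bound_def split: if_splits)
    also have "\<dots> = n div 2 + of_bool (odd n)"
      by (auto simp: card_image inj_on_def card_insert_if)
    also have "\<dots> = size M" using n that(2) by (simp add: long_tail_def)
    finally show "size N \<le> size M" .
  qed
  then have max: "maximum Y" "maximum Z" using bounded by (simp_all add: Y_def Z_def)
  have "strong_exchange (cycle_verts n) (W_set (cycle_verts n) (cycle_edges n) (long_bound n)
      :: ((nat \<Rightarrow>\<^sub>0 nat) \<Rightarrow>\<^sub>0 'k) set)"
    using exch by (simp add: graph_strong_exchange_def long_bound_def)
  moreover have "1 \<in> cycle_verts n" "5 \<in> cycle_verts n" "deg Z 1 < deg Y 1" "deg Y 5 < deg Z 5"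
    using n by (simp_all add: cycle_verts_def degY degZ deg_long_tail)
  ultimately obtain Y' where Y': "maximum Y'"
    and deg: "\<And>w. deg Y' w + of_bool (w = 1) = deg Y w + of_bool (w = 5)"
    unfolding strong_exchange_W_set using max by blast
  have "deg M 5 + deg M 7 \<le> deg M 4 + deg M 6 + deg M 8" if "set_mset M \<subseteq> cycle_edges n" for M
    using that
  proof (induction M)
    case (add e M)
    then consider i where "e = {i, i + 1}" | "e = {n, 1}"
      by (auto simp: cycle_edges_def)
    then have "e = {4, 5} \<or> e = {5, 6} \<or> e = {6, 7} \<or> e = {7, 8} \<or> (5 \<notin> e \<and> 7 \<notin> e)"
    proof cases
      case (1 i)
      consider "i = 4" | "i = 5" | "i = 6" | "i = 7" | "i \<notin> {4, 5, 6, 7}" by blast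
      then show ?thesis using 1 by cases simp_all
    qed (use n in simp)
    then have "(of_bool (5 \<in> e) + of_bool (7 \<in> e) :: nat) \<le> of_bool (4 \<in> e) + of_bool (6 \<in> e) + of_bool (8 \<in> e)"
      by (elim disjE) simp_all
    then show ?case using add by simp
  qed simp
  then have "deg Y' 5 + deg Y' 7 \<le> deg Y' 4 + deg Y' 6 + deg Y' 8"
    using Y' by (simp add: maximum_def bounded_def)
  moreover have "deg Y' 4 = 1" "deg Y' 5 = 2" "deg Y' 6 = 1" "deg Y' 7 = 2" "deg Y' 8 = 1"
    using deg[of 4] deg[of 5] deg[of 6] deg[of 7] deg[of 8] n
    by (auto simp: degY deg_long_tail)
  ultimately show False by simp
qed

theorem theorem3p5:
  fixes n :: nat
  assumes "n \<ge> 3"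
  shows "graph_strong_exchange TYPE('k::field) (cycle_verts n) (cycle_edges n)
           \<longleftrightarrow> 3 \<le> n \<and> n \<le> 7"
proof
  assume "graph_strong_exchange TYPE('k::field) (cycle_verts n) (cycle_edges n)"
  then have "\<not> 8 \<le> n" using long_cycle_not_exchange by blast
  with assms show "3 \<le> n \<and> n \<le> 7" by simp
next
  assume n: "3 \<le> n \<and> n \<le> 7"
  show "graph_strong_exchange TYPE('k) (cycle_verts n) (cycle_edges n)"
    unfolding graph_strong_exchange_def
  proof (intro allI impI)
    fix c :: "nat \<Rightarrow> nat"
    interpret cycle_graph n c
      by unfold_locales (use simple_graph_cycle[OF assms] n in simp_all)
    show "strong_exchange (cycle_verts n) (W_set (cycle_verts n) (cycle_edges n) c :: ((nat \<Rightarrow>\<^sub>0 nat) \<Rightarrow>\<^sub>0 'k) set)"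
      unfolding strong_exchange_W_set using short_cycle_exchange n by blast
  qed
qed

end
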